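(* There exists an absolute constant $C_1>0$ such that the following holds. Let $s_*\in\{2,\dots,p\}$ be such that $\theta_*>0$ and $s_*\le p/(2e)$, and let $C_0=7(4+\sqrt2)/(2\theta_* )$. Let $\hat s$ and $\tilde{\boldsymbol\beta}$ be the adaptive estimators defined in the context. Then for all $s=1,\dots,s_*$, $$\sup_{\boldsymbol\beta^*\in B_0(s)}\mathbb P_{\boldsymbol\beta^*}\left(\|\mathbb X(\tilde{\boldsymbol\beta}-\boldsymbol\beta^* )\|_n\ge C_1C_0\,\sigma\sqrt{\frac{s\log(2ep/s)}n}\right)\le\big(2(\log_2(p))^2+1\big)\left(\frac{2s}p\right)^{2s}$$ and $$\inf_{\boldsymbol\beta^*\in B_0(s)}\mathbb P_{\boldsymbol\beta^*}(\hat s\le s)\ge1-2(\log_2(p))^2\left(\frac{2s}p\right)^{2s}.$$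
   Context: Let $n,p\ge1$ be integers, $\sigma>0$, and let $\mathbb X\in\mathbb R^{n\times p}$ be a deterministic matrix with $\|\mathbb X\boldsymbol e_j\|_n\le1$ for all $j=1,\dots,p$, where $(\boldsymbol e_j)$ is the canonical basis of $\mathbb R^p$ and $\|\boldsymbol u\|_n^2=\frac1n\sum_{i=1}^nu_i^2$. The model is $\mathbf y=\mathbb X\boldsymbol\beta^*+\boldsymbol\xi$ with $\boldsymbol\xi\sim\mathcal N(\mathbf 0,\sigma^2I_{n\times n})$, and $\mathbb P_{\boldsymbol\beta^*}$ is the corresponding probability measure. $|\cdot|_q$ is the $\ell_q$ norm on $\mathbb R^p$ and $B_0(s)=\{\boldsymbol\beta\in\mathbb R^p:|\boldsymbol\beta|_0\le s\}$, where $|\boldsymbol\beta|_0$ is the number of nonzero components. Set $\theta_*=\theta(2s_*,7)$, where $$\theta(s,c_0)=\min_{\boldsymbol\delta\ne\mathbf 0,\ |\boldsymbol\delta|_1\le(1+c_0)\sqrt s|\boldsymbol\delta|_2}\frac{\|\mathbb X\boldsymbol\delta\|_n}{|\boldsymbol\delta|_2}.$$ For $s\in\{1,\dots,p\}$, $\hat{\boldsymbol\beta}_s$ denotes the Lasso estimator, i.e. a solution of $\min_{\boldsymbol\beta\in\mathbb R^p}\big(\|\mathbb X\boldsymbol\beta-\mathbf y\|_n^2+2\lambda(s)|\boldsymbol\beta|_1\big)$, with $\lambda(s)=2(4+\sqrt2)\sigma\sqrt{\log(2ep/s)/n}$. Let $b_j=2^{j-1}$ for $j\in\mathbb N=\{1,2,\dots\}$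 and $M=\max\{m\in\mathbb N:b_m\le s_*\}$ (so $M\ge2$). Let $d(\boldsymbol\beta,\boldsymbol\beta')=\|\mathbb X(\boldsymbol\beta-\boldsymbol\beta')\|_n$ and $w(b)=C_0\sigma\sqrt{b\log(2ep/b)/n}$ for $b\in[1,p]$. Define $$\hat m=\min\big\{m\in\{2,\dots,M\}:d(\hat{\boldsymbol\beta}_{b_k},\hat{\boldsymbol\beta}_{b_{k-1}})\le2w(b_k)\ \text{for all }k\in\{m,\dots,M\}\big\},$$ with the convention $\hat m=M$ if this set is empty. The adaptive estimators are $$\hat s=b_{\hat m-1}=2^{\hat m-2},\qquad\tilde{\boldsymbol\beta}=\hat{\boldsymbol\beta}_{2\hat s}=\hat{\boldsymbol\beta}_{b_{\hat m}}.$$ *)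

theory Defs
  imports "HOL-Probability.Probability" "Jordan_Normal_Form.Matrix"
begin

unbundle no vec_syntax
hide_const (open) Finite_Cartesian_Product.vec Finite_Cartesian_Product.mat

text \<open>
  Since \<open>n\<close> and \<open>p\<close> are quantified inside the main statement (the constant has to be chosen
  before them), \<open>\<real>\<^sup>n\<close> is \<^term>\<open>carrier_vec n :: real vec set\<close>, with indices \<open>0, \<dots>, n - 1\<close>, and
  \<open>\<real>\<^bsup>n\<times>p\<^esup>\<close> is \<^term>\<open>carrier_mat n p :: real mat set\<close>.
\<close>

definition emp_norm :: "real vec \<Rightarrow> real" where
  "emp_norm u = sqrt ((\<Sum>i<dim_vec u. (u $ i)\<^sup>2) / real (dim_vec u))"

definition l0 :: "real vec \<Rightarrow> nat" where
  "l0 v = card {j. j < dim_vec v \<and> v $ j \<noteq> 0}"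

definition l1 :: "real vec \<Rightarrow> real" where
  "l1 v = (\<Sum>j<dim_vec v. \<bar>v $ j\<bar>)"

definition l2 :: "real vec \<Rightarrow> real" where
  "l2 v = sqrt (\<Sum>j<dim_vec v. (v $ j)\<^sup>2)"

definition B0 :: "nat \<Rightarrow> nat \<Rightarrow> real vec set" where
  "B0 p s = {\<beta> \<in> carrier_vec p. l0 \<beta> \<le> s}"

text \<open>
  For \<open>p \<ge> 1\<close>, \<open>s \<ge> 1\<close>, \<open>c\<^sub>0 \<ge> 0\<close> the cone is nonempty and the quotient is invariant under scaling,
  so by compactness the infimum is a minimum.
\<close>

definition theta :: "real mat \<Rightarrow> real \<Rightarrow> real \<Rightarrow> real" where
  "theta X s c0 =
    (INF \<delta> \<in> {\<delta> \<in> carrier_vec (dim_col X).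
               \<delta> \<noteq> 0\<^sub>v (dim_col X) \<and> l1 \<delta> \<le> (1 + c0) * sqrt s * l2 \<delta>}.
       emp_norm (X *\<^sub>v \<delta>) / l2 \<delta>)"

definition noise :: "nat \<Rightarrow> real \<Rightarrow> (nat \<Rightarrow> real) measure" where
  "noise n \<sigma> = (\<Pi>\<^sub>M i\<in>{..<n}. density lborel (normal_density 0 \<sigma>))"

text \<open>
  \<open>model_prob X \<sigma> \<beta> E\<close> is the probability of \<open>E y\<close> under the model \<open>y = X \<beta> + \<xi>\<close> with
  \<open>\<xi> \<sim> N(0, \<sigma>\<^sup>2 I)\<close>, that is, with independent coordinates \<open>\<xi>\<^sub>i \<sim> N(0, \<sigma>\<^sup>2)\<close>.
\<close>

definition model_prob :: "real mat \<Rightarrow> real \<Rightarrow> real vec \<Rightarrow> (real vec \<Rightarrow> bool) \<Rightarrow> real" where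
  "model_prob X \<sigma> \<beta> E =
    \<P>(\<xi> in noise (dim_row X) \<sigma>. E (X *\<^sub>v \<beta> + vec (dim_row X) \<xi>))"

definition lasso_tuning :: "real mat \<Rightarrow> real \<Rightarrow> nat \<Rightarrow> real" where
  "lasso_tuning X \<sigma> s = 2 * (4 + sqrt 2) * \<sigma>
     * sqrt (ln (2 * exp 1 * real (dim_col X) / real s) / real (dim_row X))"

definition is_lasso :: "real mat \<Rightarrow> real \<Rightarrow> nat \<Rightarrow> real vec \<Rightarrow> real vec \<Rightarrow> bool" where
  "is_lasso X \<sigma> s y \<beta> \<longleftrightarrow>
     is_arg_min (\<lambda>\<beta>. (emp_norm (X *\<^sub>v \<beta> - y))\<^sup>2 + 2 * lasso_tuning X \<sigma> s * l1 \<beta>)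
       (\<lambda>\<beta>. \<beta> \<in> carrier_vec (dim_col X)) \<beta>"

text \<open>
  A Lasso solution need not be unique; \<open>\<beta>h s y\<close> is an arbitrary solution with tuning parameter
  \<open>\<lambda>(s)\<close> for the data \<open>y\<close>. Measurability in \<open>y\<close> is not required: the fitted values
  \<open>X (\<beta>h s y)\<close>, through which alone the selection below and the prediction error depend on the
  estimators, are uniquely determined and 1-Lipschitz in \<open>y\<close>.
\<close>

definition lasso_estimators ::
    "real mat \<Rightarrow> real \<Rightarrow> (nat \<Rightarrow> real vec \<Rightarrow> real vec) \<Rightarrow> bool" where
  "lasso_estimators X \<sigma> \<beta>h \<longleftrightarrow>
     (\<forall>s\<in>{1..dim_col X}. \<forall>y\<in>carrier_vec (dim_row X). is_lasso X \<sigma> s y (\<beta>h s y))"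

definition pred_dist :: "real mat \<Rightarrow> real vec \<Rightarrow> real vec \<Rightarrow> real" where
  "pred_dist X \<beta> \<beta>' = emp_norm (X *\<^sub>v (\<beta> - \<beta>'))"

definition rate :: "real mat \<Rightarrow> real \<Rightarrow> real \<Rightarrow> real \<Rightarrow> real" where
  "rate X \<sigma> C0 b = C0 * \<sigma> * sqrt (b * ln (2 * exp 1 * real (dim_col X) / b) / real (dim_row X))"

definition grid :: "nat \<Rightarrow> nat" where
  "grid j = 2 ^ (j - 1)"

definition grid_max :: "nat \<Rightarrow> nat" where
  "grid_max sstar = Max {m. 1 \<le> m \<and> grid m \<le> sstar}"

definition m_hat :: "real mat \<Rightarrow> real \<Rightarrow> real \<Rightarrow> nat \<Rightarrow> (nat \<Rightarrow> real vec \<Rightarrow> real vec) \<Rightarrow> real vec \<Rightarrow> nat" where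
  "m_hat X \<sigma> C0 sstar \<beta>h y =
    (let M = grid_max sstar;
         A = {m \<in> {2..M}. \<forall>k\<in>{m..M}.
                pred_dist X (\<beta>h (grid k) y) (\<beta>h (grid (k - 1)) y) \<le> 2 * rate X \<sigma> C0 (grid k)}
     in if A = {} then M else Min A)"

definition s_hat :: "real mat \<Rightarrow> real \<Rightarrow> real \<Rightarrow> nat \<Rightarrow> (nat \<Rightarrow> real vec \<Rightarrow> real vec) \<Rightarrow> real vec \<Rightarrow> nat" where
  "s_hat X \<sigma> C0 sstar \<beta>h y = grid (m_hat X \<sigma> C0 sstar \<beta>h y - 1)"

definition beta_tilde ::
    "real mat \<Rightarrow> real \<Rightarrow> real \<Rightarrow> nat \<Rightarrow> (nat \<Rightarrow> real vec \<Rightarrow> real vec) \<Rightarrow> real vec \<Rightarrow> real vec" where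
  "beta_tilde X \<sigma> C0 sstar \<beta>h y = \<beta>h (2 * s_hat X \<sigma> C0 sstar \<beta>h y) y"


lemma lasso_tuning_nonneg:
  assumes "\<sigma> \<ge> 0" "1 \<le> s" "s \<le> dim_col X"
  shows "lasso_tuning X \<sigma> s \<ge> 0"
proof -
  have e: "1 \<le> 2 * exp (1::real)" using exp_ge_add_one_self[of "1::real"] by linarith
  have "real s \<le> 2 * exp 1 * real (dim_col X)"
    using mult_mono[OF e, of "real s" "real (dim_col X)"] assms(3) by simp
  then have "1 \<le> 2 * exp 1 * real (dim_col X) / real s"
    using assms(2) by (simp add: field_simps)
  then have "0 \<le> ln (2 * exp 1 * real (dim_col X) / real s)" by (rule ln_ge_zero)
  then show ?thesis
    unfolding lasso_tuning_def using assms(1) by simp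
qed

lemma emp_norm_sq:
  "(emp_norm u)\<^sup>2 = (\<Sum>i<dim_vec u. (u $ i)\<^sup>2) / real (dim_vec u)"
  unfolding emp_norm_def by (simp add: sum_nonneg)

lemma is_lasso_first_order:
  assumes X: "X \<in> carrier_mat n p" and n: "n \<ge> 1" and y: "y \<in> carrier_vec n"
    and tun: "lasso_tuning X \<sigma> s \<ge> 0"
    and las: "is_lasso X \<sigma> s y \<beta>" and \<beta>': "\<beta>' \<in> carrier_vec p"
  shows "0 \<le> (\<Sum>i<n. ((X *\<^sub>v \<beta>) $ i - y $ i) * ((X *\<^sub>v \<beta>') $ i - (X *\<^sub>v \<beta>) $ i)) / real n
            + lasso_tuning X \<sigma> s * (l1 \<beta>' - l1 \<beta>)" (is "0 \<le> ?S / real n + ?l * ?\<Delta>")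
proof -
  let ?a = "\<lambda>i. (X *\<^sub>v \<beta>) $ i" and ?a' = "\<lambda>i. (X *\<^sub>v \<beta>') $ i"
  let ?D = "\<Sum>i<n. (?a' i - ?a i)\<^sup>2"
  have \<beta>: "\<beta> \<in> carrier_vec p" using las X unfolding is_lasso_def is_arg_min_def by auto
  have obj: "(\<Sum>i<n. ((X *\<^sub>v \<beta>) $ i - y $ i)\<^sup>2) / real n + 2 * ?l * l1 \<beta>
      \<le> (\<Sum>i<n. ((X *\<^sub>v \<gamma>) $ i - y $ i)\<^sup>2) / real n + 2 * ?l * l1 \<gamma>"
    if "\<gamma> \<in> carrier_vec p" for \<gamma>
    using las X y \<beta> that unfolding is_lasso_def is_arg_min_def
    by (auto simp: emp_norm_sq not_less)
  have step: "0 \<le> 2 * (?S / real n + ?l * ?\<Delta>) + t * (?D / real n)" if t: "0 < t" "t \<le> 1" for t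
  proof -
    let ?g = "vec p (\<lambda>j. (1 - t) * \<beta> $ j + t * \<beta>' $ j)"
    have Xg: "(X *\<^sub>v ?g) $ i = (1 - t) * ?a i + t * ?a' i" if "i < n" for i
      using that X \<beta> \<beta>'
      by (simp add: scalar_prod_def sum_distrib_left distrib_left sum.distrib mult_ac)
    have "l1 ?g \<le> (\<Sum>j<p. (1 - t) * \<bar>\<beta> $ j\<bar> + t * \<bar>\<beta>' $ j\<bar>)"
      unfolding l1_def using t
      by (auto intro!: sum_mono order_trans[OF abs_triangle_ineq] simp: abs_mult)
    also have "\<dots> = l1 \<beta> + t * ?\<Delta>"
      using \<beta> \<beta>' by (simp add: l1_def sum.distrib flip: sum_distrib_left) (simp add: algebra_simps)
    finally have g1: "?l * l1 ?g \<le> ?l * (l1 \<beta> + t * ?\<Delta>)" using tun by (rule mult_left_mono)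
    have "(\<Sum>i<n. ((X *\<^sub>v ?g) $ i - y $ i)\<^sup>2)
        = (\<Sum>i<n. (?a i - y $ i)\<^sup>2 + 2 * t * ((?a i - y $ i) * (?a' i - ?a i)) + t\<^sup>2 * (?a' i - ?a i)\<^sup>2)"
      by (intro sum.cong refl, simp only: lessThan_iff Xg)
        (simp add: power2_eq_square algebra_simps)
    also have "\<dots> = (\<Sum>i<n. (?a i - y $ i)\<^sup>2) + 2 * t * ?S + t\<^sup>2 * ?D"
      by (simp add: sum.distrib sum_distrib_left)
    finally have "0 \<le> (2 * t * ?S + t\<^sup>2 * ?D) / real n + 2 * (?l * (t * ?\<Delta>))"
      using obj[of ?g] g1 by (simp add: add_divide_distrib algebra_simps)
    also have "\<dots> = t * (2 * (?S / real n + ?l * ?\<Delta>) + t * (?D / real n))"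
      by (simp add: add_divide_distrib algebra_simps power2_eq_square)
    finally show ?thesis using t by (simp add: zero_le_mult_iff)
  qed
  have "((\<lambda>t. 2 * (?S / real n + ?l * ?\<Delta>) + t * (?D / real n)) \<longlongrightarrow>
      2 * (?S / real n + ?l * ?\<Delta>) + 0 * (?D / real n)) (at_right 0)"
    by (intro tendsto_intros)
  moreover have "\<forall>\<^sub>F t in at_right (0::real). 0 \<le> 2 * (?S / real n + ?l * ?\<Delta>) + t * (?D / real n)"
    by (rule eventually_mono[OF eventually_at_right_real[of 0 1]], simp, rule step) auto
  ultimately have "0 \<le> 2 * (?S / real n + ?l * ?\<Delta>) + 0 * (?D / real n)"
    by (rule tendsto_lowerbound) simp
  then show ?thesis by simp
qed

lemma is_lasso_fit_lipschitz:
  assumes X: "X \<in> carrier_mat n p" and n: "n \<ge> 1"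
    and y: "y \<in> carrier_vec n" "y' \<in> carrier_vec n"
    and tun: "lasso_tuning X \<sigma> s \<ge> 0"
    and las: "is_lasso X \<sigma> s y \<beta>" "is_lasso X \<sigma> s y' \<beta>'"
  shows "(\<Sum>i<n. ((X *\<^sub>v \<beta>) $ i - (X *\<^sub>v \<beta>') $ i)\<^sup>2) \<le> (\<Sum>i<n. (y $ i - y' $ i)\<^sup>2)"
proof -
  let ?a = "\<lambda>i. (X *\<^sub>v \<beta>) $ i" and ?a' = "\<lambda>i. (X *\<^sub>v \<beta>') $ i"
  have c: "\<beta> \<in> carrier_vec p" "\<beta>' \<in> carrier_vec p"
    using las X unfolding is_lasso_def is_arg_min_def by auto
  have "0 \<le> ((\<Sum>i<n. (?a i - y $ i) * (?a' i - ?a i)) + (\<Sum>i<n. (?a' i - y' $ i) * (?a i - ?a' i))) / real n"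
    using is_lasso_first_order[OF X n y(1) tun las(1) c(2)]
      is_lasso_first_order[OF X n y(2) tun las(2) c(1)]
    by (simp add: add_divide_distrib algebra_simps)
  then have "0 \<le> (\<Sum>i<n. (?a i - y $ i) * (?a' i - ?a i) + (?a' i - y' $ i) * (?a i - ?a' i))"
    using n by (simp add: sum.distrib zero_le_divide_iff)
  also have "\<dots> \<le> (\<Sum>i<n. (y $ i - y' $ i)\<^sup>2 / 2 - (?a i - ?a' i)\<^sup>2 / 2)"
  proof (intro sum_mono)
    fix i
    have "0 \<le> ((y $ i - y' $ i) - (?a i - ?a' i))\<^sup>2" by simp
    then show "(?a i - y $ i) * (?a' i - ?a i) + (?a' i - y' $ i) * (?a i - ?a' i)
        \<le> (y $ i - y' $ i)\<^sup>2 / 2 - (?a i - ?a' i)\<^sup>2 / 2"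
      by (simp add: power2_eq_square field_simps)
  qed
  finally show ?thesis by (simp add: sum_subtractf flip: sum_divide_distrib)
qed

lemma sets_noise [measurable_cong]: "sets (noise n \<sigma>) = sets (\<Pi>\<^sub>M i\<in>{..<n}. (borel :: real measure))"
  unfolding noise_def by (intro sets_PiM_cong) auto

lemma measurable_lasso_fit:
  assumes X: "X \<in> carrier_mat n p" and n: "n \<ge> 1" and "\<sigma> \<ge> 0"
    and las: "lasso_estimators X \<sigma> \<beta>h" and s: "1 \<le> s" "s \<le> p"
    and z: "z \<in> carrier_vec n" and i: "i < n"
  shows "(\<lambda>\<xi>. (X *\<^sub>v \<beta>h s (z + vec n \<xi>)) $ i) \<in> borel_measurable (noise n \<sigma>)"
proof -
  let ?g = "\<lambda>\<xi>. (X *\<^sub>v \<beta>h s (z + vec n \<xi>)) $ i"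
  have tun: "lasso_tuning X \<sigma> s \<ge> 0" using lasso_tuning_nonneg[of \<sigma> s X] assms by auto
  have lip: "\<bar>?g \<xi> - ?g \<xi>'\<bar> \<le> sqrt (\<Sum>i<n. (\<xi> i - \<xi>' i)\<^sup>2)" for \<xi> \<xi>'
  proof -
    have "(?g \<xi> - ?g \<xi>')\<^sup>2
        \<le> (\<Sum>i<n. ((X *\<^sub>v \<beta>h s (z + vec n \<xi>)) $ i - (X *\<^sub>v \<beta>h s (z + vec n \<xi>')) $ i)\<^sup>2)"
      using i by (intro member_le_sum) auto
    also have "\<dots> \<le> (\<Sum>i<n. ((z + vec n \<xi>) $ i - (z + vec n \<xi>') $ i)\<^sup>2)"
      using X z las s unfolding lasso_estimators_def
      by (intro is_lasso_fit_lipschitz[OF X n _ _ tun]) auto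
    also have "\<dots> = (\<Sum>i<n. (\<xi> i - \<xi>' i)\<^sup>2)" using z by simp
    finally show ?thesis by (simp add: real_le_rsqrt flip: real_sqrt_abs)
  qed
  have "continuous_on UNIV ?g"
    unfolding continuous_on_def
  proof
    fix \<xi> :: "nat \<Rightarrow> real"
    have coord: "((\<lambda>\<xi>'. \<xi>' k) \<longlongrightarrow> \<xi> k) (at \<xi>)" for k
      using continuous_on_product_coordinates[of k] unfolding continuous_on_def by auto
    have "((\<lambda>\<xi>'. sqrt (\<Sum>i<n. (\<xi>' i - \<xi> i)\<^sup>2)) \<longlongrightarrow> sqrt (\<Sum>i<n. (\<xi> i - \<xi> i)\<^sup>2)) (at \<xi>)"
      by (intro tendsto_intros coord)
    then have "((\<lambda>\<xi>'. sqrt (\<Sum>i<n. (\<xi>' i - \<xi> i)\<^sup>2)) \<longlongrightarrow> 0) (at \<xi>)" by simp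
    then have "((\<lambda>\<xi>'. ?g \<xi>' - ?g \<xi>) \<longlongrightarrow> 0) (at \<xi>)"
      by (rule Lim_null_comparison[rotated]) (auto simp: lip)
    then show "(?g \<longlongrightarrow> ?g \<xi>) (at \<xi>)" using Lim_null by blast
  qed
  then have g: "?g \<in> borel_measurable borel" by (rule borel_measurable_continuous_onI)
  have "(\<lambda>\<xi>. \<xi>) \<in> (\<Pi>\<^sub>M i\<in>{..<n}. (borel :: real measure)) \<rightarrow>\<^sub>M (\<Pi>\<^sub>M i\<in>UNIV. borel)"
  proof (rule measurable_PiM_single')
    fix k :: nat
    show "(\<lambda>\<xi>. \<xi> k) \<in> borel_measurable (\<Pi>\<^sub>M i\<in>{..<n}. (borel :: real measure))"
    proof (cases "k < n")
      case False
      then have "\<And>\<xi>. \<xi> \<in> space (\<Pi>\<^sub>M i\<in>{..<n}. (borel :: real measure)) \<Longrightarrow> \<xi> k = undefined"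
        by (auto simp: space_PiM PiE_def extensional_def)
      then show ?thesis by (subst measurable_cong[where g = "\<lambda>_. undefined"]) auto
    qed simp
  qed auto
  then have "(\<lambda>\<xi>. \<xi>) \<in> borel_measurable (noise n \<sigma>)"
    by (simp add: sets_PiM_equal_borel cong: measurable_cong_sets add: sets_noise)
  from measurable_compose[OF this g] show ?thesis .
qed

lemma measurable_pred_loss:
  assumes X: "X \<in> carrier_mat n p" and n: "n \<ge> 1" and "\<sigma> \<ge> 0"
    and las: "lasso_estimators X \<sigma> \<beta>h" and s: "1 \<le> s" "s \<le> p" "1 \<le> s'" "s' \<le> p"
    and z: "z \<in> carrier_vec n" and b: "b \<in> carrier_vec p"
  shows "(\<lambda>\<xi>. pred_dist X (\<beta>h s (z + vec n \<xi>)) (\<beta>h s' (z + vec n \<xi>))) \<in> borel_measurable (noise n \<sigma>)"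
    and "(\<lambda>\<xi>. pred_dist X (\<beta>h s (z + vec n \<xi>)) b) \<in> borel_measurable (noise n \<sigma>)"
proof -
  have c: "\<beta>h r (z + vec n \<xi>) \<in> carrier_vec p" if "1 \<le> r" "r \<le> p" for r \<xi>
    using las X z that unfolding lasso_estimators_def is_lasso_def is_arg_min_def by fastforce
  have eq: "pred_dist X u v = sqrt ((\<Sum>i<n. ((X *\<^sub>v u) $ i - (X *\<^sub>v v) $ i)\<^sup>2) / real n)"
    if "u \<in> carrier_vec p" "v \<in> carrier_vec p" for u v
    using X that by (simp add: pred_dist_def emp_norm_def mult_minus_distrib_mat_vec)
  note m = measurable_lasso_fit[OF X n \<open>\<sigma> \<ge> 0\<close> las _ _ z]
  show "(\<lambda>\<xi>. pred_dist X (\<beta>h s (z + vec n \<xi>)) (\<beta>h s' (z + vec n \<xi>))) \<in> borel_measurable (noise n \<sigma>)"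
    unfolding eq[OF c[OF s(1,2)] c[OF s(3,4)]] using s
    by (intro measurable_compose[OF _ borel_measurable_sqrt] borel_measurable_divide
        borel_measurable_sum borel_measurable_power borel_measurable_diff borel_measurable_const m) auto
  show "(\<lambda>\<xi>. pred_dist X (\<beta>h s (z + vec n \<xi>)) b) \<in> borel_measurable (noise n \<sigma>)"
    unfolding eq[OF c[OF s(1,2)] b] using s
    by (intro measurable_compose[OF _ borel_measurable_sqrt] borel_measurable_divide
        borel_measurable_sum borel_measurable_power borel_measurable_diff borel_measurable_const m) auto
qed

lemma grid_max:
  assumes "2 \<le> sstar"
  shows "2 \<le> grid_max sstar" "1 \<le> m \<Longrightarrow> m \<le> grid_max sstar \<Longrightarrow> grid m \<le> sstar"
proof -
  let ?A = "{m. 1 \<le> m \<and> grid m \<le> sstar}"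
  have "m \<le> Suc sstar" if "m \<in> ?A" for m
  proof -
    have "2 ^ (m - 1) \<le> sstar" using that by (simp add: grid_def)
    with less_exp[of "m - 1"] have "m - 1 < sstar" by (rule less_le_trans)
    then show ?thesis by simp
  qed
  then have fin: "finite ?A" by (auto intro: finite_subset[of _ "{..Suc sstar}"])
  have 2: "2 \<in> ?A" using assms by (simp add: grid_def)
  show "2 \<le> grid_max sstar" unfolding grid_max_def using fin 2 by (rule Max_ge)
  have "grid (grid_max sstar) \<le> sstar"
    using Max_in[OF fin] 2 unfolding grid_max_def by blast
  moreover have "grid m \<le> grid (grid_max sstar)" if "m \<le> grid_max sstar"
    unfolding grid_def using that by (intro power_increasing) auto
  ultimately show "grid m \<le> sstar" if "1 \<le> m" "m \<le> grid_max sstar"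
    using that by linarith
qed

lemma m_hat_bounds:
  assumes "2 \<le> sstar"
  shows "2 \<le> m_hat X \<sigma> C0 sstar \<beta>h y" "m_hat X \<sigma> C0 sstar \<beta>h y \<le> grid_max sstar"
proof -
  let ?A = "{m \<in> {2..grid_max sstar}. \<forall>k\<in>{m..grid_max sstar}.
    pred_dist X (\<beta>h (grid k) y) (\<beta>h (grid (k - 1)) y) \<le> 2 * rate X \<sigma> C0 (grid k)}"
  have "m_hat X \<sigma> C0 sstar \<beta>h y \<in> {2..grid_max sstar}"
  proof (cases "?A = {}")
    case True
    then show ?thesis using grid_max(1)[OF assms] unfolding m_hat_def Let_def by (simp only: if_True) simp
  next
    case False
    have "Min ?A \<in> ?A" by (rule Min_in[OF _ False]) simp
    then show ?thesis using False unfolding m_hat_def Let_def by (simp only: if_False) blast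
  qed
  then show "2 \<le> m_hat X \<sigma> C0 sstar \<beta>h y" "m_hat X \<sigma> C0 sstar \<beta>h y \<le> grid_max sstar" by auto
qed

lemma if_empty_Min_eq_iff:
  fixes A :: "nat set"
  assumes A: "A \<subseteq> {..M}"
  shows "(if A = {} then M else Min A) = m \<longleftrightarrow>
    (m \<in> A \<and> (\<forall>k\<in>{..<m}. k \<notin> A)) \<or> ((\<forall>k\<in>{..M}. k \<notin> A) \<and> m = M)"
proof (cases "A = {}")
  case False
  have "finite A" using A by (rule finite_subset) simp
  then have "Min A = m \<longleftrightarrow> m \<in> A \<and> (\<forall>k\<in>A. m \<le> k)" using False by (intro Min_eq_iff)
  also have "(\<forall>k\<in>A. m \<le> k) \<longleftrightarrow> (\<forall>k\<in>{..<m}. k \<notin> A)" by (meson lessThan_iff not_le)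
  finally show ?thesis using False A by auto
qed auto

lemma measurable_if_empty_Min:
  fixes A :: "'a \<Rightarrow> nat set"
  assumes sub: "\<And>x. A x \<subseteq> {..M}" and R: "\<And>m. Measurable.pred N (\<lambda>x. m \<in> A x)"
  shows "(\<lambda>x. if A x = {} then M else Min (A x)) \<in> N \<rightarrow>\<^sub>M count_space UNIV" (is "?f \<in> _")
proof -
  have "Measurable.pred N (\<lambda>x. ?f x = m)" for m
  proof -
    have 1: "Measurable.pred N (\<lambda>x. \<forall>k\<in>K. k \<notin> A x)" if "finite K" for K
      using that R by (intro pred_intros_finite pred_intros_logic(2))
    have "Measurable.pred N (\<lambda>x. (m \<in> A x \<and> (\<forall>k\<in>{..<m}. k \<notin> A x)) \<or> ((\<forall>k\<in>{..M}. k \<notin> A x) \<and> m = M))"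
      by (intro pred_intros_logic(3,5) R 1 finite_lessThan finite_atMost measurable_const) simp
    then show ?thesis by (simp only: if_empty_Min_eq_iff[OF sub])
  qed
  then have "{x \<in> space N. ?f x = m} \<in> sets N" for m by (simp only: pred_def)
  then show ?thesis
    unfolding measurable_count_space_eq2_countable by (simp add: vimage_def Int_def conj_commute)
qed

lemma measurable_m_hat:
  assumes X: "X \<in> carrier_mat n p" and n: "n \<ge> 1" and "\<sigma> \<ge> 0"
    and las: "lasso_estimators X \<sigma> \<beta>h" and ss: "2 \<le> sstar" "sstar \<le> p"
    and z: "z \<in> carrier_vec n"
  shows "(\<lambda>\<xi>. m_hat X \<sigma> C0 sstar \<beta>h (z + vec n \<xi>)) \<in> noise n \<sigma> \<rightarrow>\<^sub>M count_space UNIV"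
proof -
  let ?M = "grid_max sstar"
  let ?P = "\<lambda>k \<xi>. pred_dist X (\<beta>h (grid k) (z + vec n \<xi>)) (\<beta>h (grid (k - 1)) (z + vec n \<xi>))
    \<le> 2 * rate X \<sigma> C0 (grid k)"
  let ?A = "\<lambda>\<xi>. {m \<in> {2..?M}. \<forall>k\<in>{m..?M}. ?P k \<xi>}"
  have P: "Measurable.pred (noise n \<sigma>) (?P k)" if "k \<in> {2..?M}" for k
  proof -
    have "1 \<le> k" "k \<le> ?M" "1 \<le> k - 1" "k - 1 \<le> ?M" using that by auto
    from grid_max(2)[OF ss(1) this(1,2)] grid_max(2)[OF ss(1) this(3,4)]
    have "grid k \<le> p" "grid (k - 1) \<le> p" "1 \<le> grid k" "1 \<le> grid (k - 1)"
      using ss(2) by (linarith, linarith, simp_all add: grid_def)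
    from measurable_pred_loss(1)[OF X n \<open>\<sigma> \<ge> 0\<close> las this(3,1,4,2) z zero_carrier_vec]
    show ?thesis by measurable
  qed
  have Q: "Measurable.pred (noise n \<sigma>) (\<lambda>\<xi>. \<forall>k\<in>{m..?M}. ?P k \<xi>)" if "2 \<le> m" for m
  proof (intro pred_intros_finite)
    fix k assume "k \<in> {m..?M}"
    then have "k \<in> {2..?M}" using that by simp
    then show "Measurable.pred (noise n \<sigma>) (?P k)" by (rule P)
  qed simp
  have R: "Measurable.pred (noise n \<sigma>) (\<lambda>\<xi>. m \<in> ?A \<xi>)" for m
  proof (cases "m \<in> {2..?M}")
    case True
    then have "2 \<le> m" by simp
    then show ?thesis using Q[of m] by (simp only: mem_Collect_eq True simp_thms)
  next
    case False
    then show ?thesis by (simp only: mem_Collect_eq simp_thms) simp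
  qed
  show ?thesis
    unfolding m_hat_def Let_def by (rule measurable_if_empty_Min[OF _ R]) auto
qed

text \<open>
  The two events of the main statement, viewed as sets of noise vectors, are measurable.
\<close>

lemma events_measurable:
  assumes X: "X \<in> carrier_mat n p" and n: "n \<ge> 1" and "\<sigma> \<ge> 0"
    and las: "lasso_estimators X \<sigma> \<beta>h" and ss: "2 \<le> sstar" "sstar \<le> p"
    and \<beta>: "\<beta> \<in> carrier_vec p"
  shows "Measurable.pred (noise n \<sigma>)
      (\<lambda>\<xi>. emp_norm (X *\<^sub>v (beta_tilde X \<sigma> C0 sstar \<beta>h (X *\<^sub>v \<beta> + vec n \<xi>) - \<beta>)) \<ge> t)" (is ?A)
    and "Measurable.pred (noise n \<sigma>) (\<lambda>\<xi>. s_hat X \<sigma> C0 sstar \<beta>h (X *\<^sub>v \<beta> + vec n \<xi>) \<le> s)" (is ?B)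
proof -
  have z: "X *\<^sub>v \<beta> \<in> carrier_vec n" using X \<beta> by (rule mult_mat_vec_carrier)
  let ?y = "\<lambda>\<xi>. X *\<^sub>v \<beta> + vec n \<xi>"
  let ?m = "\<lambda>\<xi>. m_hat X \<sigma> C0 sstar \<beta>h (?y \<xi>)"
  have [measurable]: "?m \<in> noise n \<sigma> \<rightarrow>\<^sub>M count_space UNIV"
    by (rule measurable_m_hat[OF X n \<open>\<sigma> \<ge> 0\<close> las ss z])
  show ?B unfolding s_hat_def by measurable
  have bt: "beta_tilde X \<sigma> C0 sstar \<beta>h (?y \<xi>) = \<beta>h (grid (?m \<xi>)) (?y \<xi>)" for \<xi>
  proof -
    obtain k where "?m \<xi> = 2 + k"
      using m_hat_bounds(1)[OF ss(1), of X \<sigma> C0 \<beta>h "?y \<xi>"] le_Suc_ex by blast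
    then show ?thesis by (simp add: beta_tilde_def s_hat_def grid_def)
  qed
  have eq: "emp_norm (X *\<^sub>v (beta_tilde X \<sigma> C0 sstar \<beta>h (?y \<xi>) - \<beta>)) \<ge> t \<longleftrightarrow>
      (\<exists>m\<in>{2..grid_max sstar}. ?m \<xi> = m \<and> pred_dist X (\<beta>h (grid m) (?y \<xi>)) \<beta> \<ge> t)" for \<xi>
    using m_hat_bounds[OF ss(1), of X \<sigma> C0 \<beta>h "?y \<xi>"] by (auto simp: bt pred_dist_def)
  have L: "(\<lambda>\<xi>. pred_dist X (\<beta>h (grid m) (?y \<xi>)) \<beta>) \<in> borel_measurable (noise n \<sigma>)"
    if "m \<in> {2..grid_max sstar}" for m
  proof -
    have m: "1 \<le> grid m" "grid m \<le> p"
      using grid_max(2)[OF ss(1), of m] that ss by (auto simp: grid_def)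
    show ?thesis by (rule measurable_pred_loss(2)[OF X n \<open>\<sigma> \<ge> 0\<close> las m m z \<beta>])
  qed
  show ?A unfolding eq
  proof (intro pred_intros_finite)
    fix m assume "m \<in> {2..grid_max sstar}"
    note [measurable] = L[OF this]
    show "Measurable.pred (noise n \<sigma>) (\<lambda>\<xi>. ?m \<xi> = m \<and> pred_dist X (\<beta>h (grid m) (?y \<xi>)) \<beta> \<ge> t)"
      by measurable
  qed simp
qed

end

theory Submission
  imports Defs
begin

text \<open>
  All randomness is confined to one event, which does not depend on the target vector \<open>\<beta>\<close>. For a
  sparsity level \<open>m\<close> put \<open>L = ln (2 e p / m)\<close>. On an event of probability at least
  \<open>1 - (2 s / p)\<^bsup>2 s\<^esup>\<close> (for any \<open>s \<le> m \<le> p / (2 e)\<close>) the noise satisfies, simultaneously for all \<open>u\<close>,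
  \<open>\<langle>\<xi>, X u\<rangle> \<le> 5/2 \<sigma> sqrt (m L) (\<bar>X u\<bar>\<^sub>2 + \<bar>u\<bar>\<^sub>1 sqrt (n / m))\<close>.
  The first summand on the right is the price for the confidence level, the second one is what the
  \<open>l\<^sub>1\<close> penalty absorbs.

  This uniform bound comes from Maurey's empirical method in place of Gaussian concentration. After
  scaling, \<open>X u\<close> is a convex combination of the \<open>2 p\<close> signed columns of \<open>X\<close>, hence the
  mean of an average of \<open>m\<close> independent signed columns, whose squared norm has mean at most
  \<open>\<bar>X u\<bar>\<^sub>2\<^sup>2 + n / m\<close>. The linear form \<open>\<langle>\<xi>, \<cdot>\<rangle>\<close> has no bias under this randomisation, so it
  is enough to control it on the sums of \<open>m\<close> signed columns. There are at most
  \<open>(4 e p / m)\<^sup>m\<close> of those, and each is handled by the one-dimensional Gaussian tail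
  (\<open>convex_comb_noise_bound\<close>, \<open>noise_not_controlled_le\<close>, \<open>noise_controlled_bound\<close>).

  On the event for level \<open>m\<close> the first-order condition of the Lasso and the restricted eigenvalue
  \<open>theta\<close> give prediction error at most \<open>rate m\<close> for every tuning level \<open>b\<close> with
  \<open>b \<le> m \<le> 2 b\<close> and every \<open>m\<close>-sparse target (\<open>lasso_error_le_rate\<close>). The factor two is
  essential: if \<open>s \<le> grid k\<close>, then both the fit at \<open>grid k\<close> and the one at \<open>grid (k - 1)\<close> are
  within \<open>rate (grid k)\<close> of the target, although the target need not be
  \<open>grid (k - 1)\<close>-sparse. Hence their distance passes the threshold \<open>2 rate (grid k)\<close>, and the
  selected index is at most that of the first grid point reaching \<open>s\<close>; \<open>s_hat\<close> is the grid point
  before the selected one, hence at most \<open>s\<close>.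
  Moreover, the selected fit and the fit at that grid point are joined by consecutive comparisons
  that all passed the test. The rates grow geometrically along the grid, so the comparisons add up to a
  multiple of the last rate, which is comparable to \<open>rate s\<close>
  (\<open>selection_of_accurate_fits\<close>). At most \<open>grid_max sstar \<le> log\<^sub>2 p\<close> levels \<open>m\<close> are
  used, so a union bound finishes the proof.
\<close>

section \<open>Gaussian linear forms\<close>

text \<open>
  Completing the square turns the exponential weight into a shift of the mean by \<open>c \<sigma>\<^sup>2\<close>.
\<close>

lemma nn_integral_exp_normal:
  assumes "\<sigma> > 0"
  shows "(\<integral>\<^sup>+x. ennreal (exp (c * x)) \<partial>density lborel (normal_density 0 \<sigma>))
    = ennreal (exp (c\<^sup>2 * \<sigma>\<^sup>2 / 2))"
proof -
  interpret N: prob_space "density lborel (normal_density (c * \<sigma>\<^sup>2) \<sigma>)"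
    using assms by (rule prob_space_normal_density)
  have sq: "c * x - x\<^sup>2 / (2 * \<sigma>\<^sup>2) = c\<^sup>2 * \<sigma>\<^sup>2 / 2 - (x - c * \<sigma>\<^sup>2)\<^sup>2 / (2 * \<sigma>\<^sup>2)" for x
    using assms by (simp add: field_simps power2_eq_square)
  have "normal_density 0 \<sigma> x * exp (c * x)
      = exp (c\<^sup>2 * \<sigma>\<^sup>2 / 2) * normal_density (c * \<sigma>\<^sup>2) \<sigma> x" for x
    using sq[of x] by (simp add: normal_density_def flip: exp_add)
  then have "(\<integral>\<^sup>+x. ennreal (exp (c * x)) \<partial>density lborel (normal_density 0 \<sigma>))
      = (\<integral>\<^sup>+x. ennreal (exp (c\<^sup>2 * \<sigma>\<^sup>2 / 2)) * ennreal (normal_density (c * \<sigma>\<^sup>2) \<sigma> x) \<partial>lborel)"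
    by (subst nn_integral_density) (auto simp: ennreal_mult'[symmetric] normal_density_nonneg)
  also have "\<dots> = ennreal (exp (c\<^sup>2 * \<sigma>\<^sup>2 / 2)) * emeasure (density lborel (normal_density (c * \<sigma>\<^sup>2) \<sigma>))
      (space (density lborel (normal_density (c * \<sigma>\<^sup>2) \<sigma>)))"
    by (simp add: nn_integral_cmult emeasure_density)
  finally show ?thesis by (simp only: N.emeasure_space_1 mult_1_right)
qed

lemma prob_space_noise: "\<sigma> > 0 \<Longrightarrow> prob_space (noise n \<sigma>)"
  unfolding noise_def by (intro prob_space_PiM prob_space_normal_density)

lemma measurable_noise_linear:
  "(\<lambda>\<xi>. \<Sum>i<n. \<xi> i * a i) \<in> borel_measurable (noise n \<sigma>)"
  by (intro borel_measurable_sum borel_measurable_times)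
     (auto simp: measurable_cong_sets[OF sets_noise refl])

lemma nn_integral_exp_noise_linear:
  assumes "\<sigma> > 0"
  shows "(\<integral>\<^sup>+\<xi>. ennreal (exp (\<Sum>i<n. \<xi> i * a i)) \<partial>noise n \<sigma>)
    = ennreal (exp (\<sigma>\<^sup>2 * (L2_set a {..<n})\<^sup>2 / 2))"
proof -
  interpret N: prob_space "density lborel (normal_density 0 \<sigma>)"
    using assms by (rule prob_space_normal_density)
  interpret P: product_sigma_finite "\<lambda>_::nat. density lborel (normal_density 0 \<sigma>)"
    by unfold_locales
  have "(\<integral>\<^sup>+\<xi>. ennreal (exp (\<Sum>i<n. \<xi> i * a i)) \<partial>noise n \<sigma>)
      = (\<integral>\<^sup>+\<xi>. (\<Prod>i<n. ennreal (exp (a i * \<xi> i))) \<partial>noise n \<sigma>)"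
    by (simp add: exp_sum prod_ennreal mult.commute)
  also have "\<dots> = (\<Prod>i<n. ennreal (exp ((a i)\<^sup>2 * \<sigma>\<^sup>2 / 2)))"
    unfolding noise_def using assms
    by (subst P.product_nn_integral_prod) (auto simp: nn_integral_exp_normal)
  also have "\<dots> = ennreal (exp (\<Sum>i<n. (a i)\<^sup>2 * \<sigma>\<^sup>2 / 2))"
    by (simp add: exp_sum prod_ennreal)
  also have "(\<Sum>i<n. (a i)\<^sup>2 * \<sigma>\<^sup>2 / 2) = \<sigma>\<^sup>2 * (L2_set a {..<n})\<^sup>2 / 2"
    by (simp add: L2_set_def sum_nonneg sum_distrib_left mult.commute flip: sum_divide_distrib)
  finally show ?thesis .
qed

text \<open>
  Chernoff's bound with \<open>h = t / (\<sigma> \<bar>a\<bar>\<^sub>2)\<close>. The inequality inside the event is strict, so that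
  the event is empty for \<open>a = 0\<close>.
\<close>

lemma noise_linear_tail:
  assumes "\<sigma> > 0" "t \<ge> 0"
  shows "measure (noise n \<sigma>) {\<xi> \<in> space (noise n \<sigma>). t * \<sigma> * L2_set a {..<n} < (\<Sum>i<n. \<xi> i * a i)}
    \<le> exp (- t\<^sup>2 / 2)" (is "measure _ ?E \<le> _")
proof (cases "L2_set a {..<n} = 0")
  case True
  then have "\<forall>i<n. a i = 0" by (subst (asm) L2_set_eq_0_iff) auto
  then have "?E = {}" using True by simp
  then show ?thesis by (metis measure_empty exp_ge_zero)
next
  case False
  then have pos: "L2_set a {..<n} > 0" using L2_set_nonneg[of a "{..<n}"] by linarith
  interpret N: prob_space "noise n \<sigma>" using assms(1) by (rule prob_space_noise)
  define h where "h = t / (\<sigma> * L2_set a {..<n})"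
  have h: "h \<ge> 0" using assms pos by (simp add: h_def)
  have h1: "h * (\<sigma> * L2_set a {..<n}) = t" using pos assms by (simp add: h_def)
  have hL: "h * (t * \<sigma> * L2_set a {..<n}) = t\<^sup>2"
    using h1 by (simp add: power2_eq_square mult_ac)
  have L: "L2_set (\<lambda>i. h * a i) {..<n} = h * L2_set a {..<n}"
    using h by (rule L2_set_right_distrib[symmetric])
  have norm: "\<sigma>\<^sup>2 * (L2_set (\<lambda>i. h * a i) {..<n})\<^sup>2 = t\<^sup>2"
    unfolding L using h1 by (metis mult.left_commute power_mult_distrib)
  have lin: "h * (\<Sum>i<n. \<xi> i * a i) = (\<Sum>i<n. \<xi> i * (h * a i))" for \<xi>
    by (simp add: sum_distrib_left mult.left_commute)
  have mgf: "(\<integral>\<^sup>+\<xi>. ennreal (exp (h * (\<Sum>i<n. \<xi> i * a i))) \<partial>noise n \<sigma>) = ennreal (exp (t\<^sup>2 / 2))"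
    by (simp only: lin nn_integral_exp_noise_linear[OF assms(1)] norm)
  note [measurable] = measurable_noise_linear[of a n \<sigma>]
  have "indicator ?E \<xi> \<le> ennreal (exp (- t\<^sup>2)) * ennreal (exp (h * (\<Sum>i<n. \<xi> i * a i)))" for \<xi>
  proof (cases "\<xi> \<in> ?E")
    case True
    then have "t * \<sigma> * L2_set a {..<n} \<le> (\<Sum>i<n. \<xi> i * a i)" by simp
    from mult_left_mono[OF this h] have "t\<^sup>2 \<le> h * (\<Sum>i<n. \<xi> i * a i)" by (simp only: hL)
    then have "1 \<le> exp (- t\<^sup>2) * exp (h * (\<Sum>i<n. \<xi> i * a i))" by (simp flip: exp_add)
    then show ?thesis using True by (simp add: ennreal_mult'[symmetric] ennreal_leI flip: ennreal_1)
  qed auto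
  then have "(\<integral>\<^sup>+\<xi>. indicator ?E \<xi> \<partial>noise n \<sigma>)
      \<le> (\<integral>\<^sup>+\<xi>. ennreal (exp (- t\<^sup>2)) * ennreal (exp (h * (\<Sum>i<n. \<xi> i * a i))) \<partial>noise n \<sigma>)"
    by (intro nn_integral_mono)
  also have "\<dots> = ennreal (exp (- t\<^sup>2)) * ennreal (exp (t\<^sup>2 / 2))"
    by (subst nn_integral_cmult) (auto simp: mgf)
  also have "\<dots> = ennreal (exp (- t\<^sup>2 / 2))"
    by (simp add: ennreal_mult'[symmetric] flip: exp_add)
  finally have "emeasure (noise n \<sigma>) ?E \<le> ennreal (exp (- t\<^sup>2 / 2))" by simp
  then show ?thesis by (simp add: N.emeasure_eq_measure)
qed

section \<open>Sparsification of convex combinations\<close>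

text \<open>
  A sum of \<open>m\<close> vectors drawn with repetition from the family \<open>z\<close> is recorded by the list of the
  multiplicities of the draws. Lists of given length and sum are the multisets of size \<open>m\<close>;
  forgetting the order of the draws is what keeps their number small.
\<close>

definition list_comb :: "(nat \<Rightarrow> nat \<Rightarrow> real) \<Rightarrow> nat list \<Rightarrow> nat \<Rightarrow> real" where
  "list_comb z c i = (\<Sum>l<length c. real (c ! l) * z l i)"

lemma list_comb_replicate_0: "list_comb z (replicate N 0) i = 0"
  by (simp add: list_comb_def)

lemma list_comb_incr:
  assumes "j < length c"
  shows "list_comb z (c[j := Suc (c ! j)]) i = list_comb z c i + z j i"
proof -
  have "list_comb z (c[j := Suc (c ! j)]) i
      = (\<Sum>l<length c. real (c ! l) * z l i + (if l = j then z l i else 0))"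
    unfolding list_comb_def using assms
    by (intro sum.cong) (auto simp: nth_list_update algebra_simps)
  also have "\<dots> = list_comb z c i + z j i"
    using assms by (simp add: sum.distrib list_comb_def)
  finally show ?thesis .
qed

lemma exists_le_weighted_average:
  fixes f q :: "nat \<Rightarrow> real"
  assumes "\<And>l. l < N \<Longrightarrow> q l \<ge> 0" "(\<Sum>l<N. q l) = 1" "(\<Sum>l<N. q l * f l) \<le> b"
  shows "\<exists>l<N. f l \<le> b"
proof (rule ccontr)
  assume "\<not> ?thesis"
  then have gt: "f l > b" if "l < N" for l using that by force
  have "\<exists>l<N. q l > 0"
  proof (rule ccontr)
    assume "\<not> (\<exists>l<N. q l > 0)"
    then have "(\<Sum>l<N. q l) = 0" using assms(1) by (intro sum.neutral) force
    then show False using assms(2) by simp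
  qed
  then obtain k where k: "k < N" "q k > 0" by auto
  have "(\<Sum>l<N. q l * b) < (\<Sum>l<N. q l * f l)"
    using k gt assms(1)
    by (intro sum_strict_mono_ex1 ballI bexI[of _ k] mult_left_mono mult_strict_left_mono)
       (auto simp: less_imp_le)
  then show False using assms by (simp flip: sum_distrib_right)
qed

text \<open>
  Maurey's method without probability. If \<open>z\<close> is drawn \<open>r\<close> times independently with the
  weights \<open>q\<close>, the mean of the quadratic functional
  \<open>v \<mapsto> \<alpha> \<bar>v\<bar>\<^sup>2 - \<langle>\<xi>, v\<rangle>\<close> at \<open>w\<close> plus the sum of the draws is at most the
  right-hand side: the linear part sees only the mean, and each draw adds at most \<open>B\<close> to the
  variance. Some outcome does not exceed the mean; it is found by fixing one draw after another. The
  offset \<open>w\<close> collects the draws already fixed.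
\<close>

lemma list_comb_below_average:
  assumes q: "\<And>l. l < N \<Longrightarrow> q l \<ge> 0" "(\<Sum>l<N. q l) = 1"
    and B: "\<And>l. l < N \<Longrightarrow> (\<Sum>i<n. (z l i)\<^sup>2) \<le> B" and \<alpha>: "\<alpha> \<ge> (0::real)"
  defines "zbar \<equiv> \<lambda>i. \<Sum>l<N. q l * z l i"
  shows "\<exists>c. length c = N \<and> sum_list c = r \<and>
    \<alpha> * (\<Sum>i<n. (w i + list_comb z c i)\<^sup>2) - (\<Sum>i<n. \<xi> i * (w i + list_comb z c i))
    \<le> \<alpha> * ((\<Sum>i<n. (w i + real r * zbar i)\<^sup>2) + real r * B) - (\<Sum>i<n. \<xi> i * (w i + real r * zbar i))"
proof (induction r arbitrary: w)
  case 0
  show ?case by (intro exI[of _ "replicate N 0"]) (simp add: list_comb_replicate_0)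
next
  case (Suc r)
  let ?a = "\<lambda>i. w i + real r * zbar i"
  let ?F = "\<lambda>l. \<alpha> * ((\<Sum>i<n. (?a i + z l i)\<^sup>2) + real r * B) - (\<Sum>i<n. \<xi> i * (?a i + z l i))"
  let ?b = "\<alpha> * ((\<Sum>i<n. (?a i + zbar i)\<^sup>2) + real (Suc r) * B) - (\<Sum>i<n. \<xi> i * (?a i + zbar i))"
  have lin: "(\<Sum>l<N. q l * (\<Sum>i<n. \<xi> i * (?a i + z l i))) = (\<Sum>i<n. \<xi> i * (?a i + zbar i))"
  proof -
    have "(\<Sum>l<N. q l * (\<Sum>i<n. \<xi> i * (?a i + z l i)))
        = (\<Sum>i<n. \<Sum>l<N. q l * (\<xi> i * (?a i + z l i)))"
      by (simp only: sum_distrib_left) (rule sum.swap)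
    also have "\<dots> = (\<Sum>i<n. \<xi> i * ((\<Sum>l<N. q l) * ?a i + zbar i))"
    proof (intro sum.cong refl)
      fix i
      have "(\<Sum>l<N. q l * (c * (a + z l i))) = c * ((\<Sum>l<N. q l) * a + zbar i)" for a c
        by (simp add: zbar_def sum_distrib_left sum_distrib_right sum.distrib algebra_simps)
      then show "(\<Sum>l<N. q l * (\<xi> i * (?a i + z l i))) = \<xi> i * ((\<Sum>l<N. q l) * ?a i + zbar i)" .
    qed
    finally show ?thesis by (simp add: q)
  qed
  have quad: "(\<Sum>l<N. q l * (\<Sum>i<n. (?a i + z l i)\<^sup>2)) \<le> (\<Sum>i<n. (?a i + zbar i)\<^sup>2) + B"
  proof -
    have "(\<Sum>l<N. q l * (\<Sum>i<n. (?a i + z l i)\<^sup>2))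
        = (\<Sum>i<n. \<Sum>l<N. q l * (?a i + z l i)\<^sup>2)"
      by (simp only: sum_distrib_left) (rule sum.swap)
    also have "\<dots> = (\<Sum>i<n. (\<Sum>l<N. q l) * (?a i)\<^sup>2 + 2 * ?a i * zbar i + (\<Sum>l<N. q l * (z l i)\<^sup>2))"
    proof (intro sum.cong refl)
      fix i
      have "(\<Sum>l<N. q l * (a + z l i)\<^sup>2)
          = (\<Sum>l<N. q l) * a\<^sup>2 + 2 * a * zbar i + (\<Sum>l<N. q l * (z l i)\<^sup>2)" for a
        by (simp add: zbar_def sum_distrib_left sum_distrib_right sum.distrib algebra_simps
            power2_eq_square)
      then show "(\<Sum>l<N. q l * (?a i + z l i)\<^sup>2)
          = (\<Sum>l<N. q l) * (?a i)\<^sup>2 + 2 * ?a i * zbar i + (\<Sum>l<N. q l * (z l i)\<^sup>2)" .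
    qed
    also have "\<dots> \<le> (\<Sum>i<n. (?a i + zbar i)\<^sup>2 + (\<Sum>l<N. q l * (z l i)\<^sup>2))"
      by (intro sum_mono) (simp add: q power2_eq_square algebra_simps)
    also have "\<dots> = (\<Sum>i<n. (?a i + zbar i)\<^sup>2) + (\<Sum>l<N. q l * (\<Sum>i<n. (z l i)\<^sup>2))"
      by (simp only: sum.distrib sum_distrib_left add_left_cancel) (rule sum.swap)
    also have "(\<Sum>l<N. q l * (\<Sum>i<n. (z l i)\<^sup>2)) \<le> (\<Sum>l<N. q l * B)"
      using q B by (intro sum_mono mult_left_mono) auto
    finally show ?thesis by (simp add: q flip: sum_distrib_right)
  qed
  have "(\<Sum>l<N. q l * ?F l) = \<alpha> * ((\<Sum>l<N. q l * (\<Sum>i<n. (?a i + z l i)\<^sup>2)) + (\<Sum>l<N. q l) * (real r * B))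
      - (\<Sum>l<N. q l * (\<Sum>i<n. \<xi> i * (?a i + z l i)))"
    by (simp add: algebra_simps sum_subtractf sum.distrib sum_distrib_left sum_distrib_right)
  also have "\<dots> \<le> ?b"
    unfolding lin using mult_left_mono[OF quad \<alpha>] by (simp add: q algebra_simps)
  finally obtain j where j: "j < N" "?F j \<le> ?b"
    using exists_le_weighted_average[OF q, of ?F ?b] by blast
  obtain c where c: "length c = N" "sum_list c = r"
    "\<alpha> * (\<Sum>i<n. (w i + z j i + list_comb z c i)\<^sup>2) - (\<Sum>i<n. \<xi> i * (w i + z j i + list_comb z c i))
    \<le> \<alpha> * ((\<Sum>i<n. (w i + z j i + real r * zbar i)\<^sup>2) + real r * B)
      - (\<Sum>i<n. \<xi> i * (w i + z j i + real r * zbar i))"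
    using Suc.IH[of "\<lambda>i. w i + z j i"] by blast
  show ?case
  proof (intro exI[of _ "c[j := Suc (c ! j)]"] conjI)
    show "sum_list (c[j := Suc (c ! j)]) = Suc r"
      using j c by (simp add: sum_list_update)
    show "\<alpha> * (\<Sum>i<n. (w i + list_comb z (c[j := Suc (c ! j)]) i)\<^sup>2)
          - (\<Sum>i<n. \<xi> i * (w i + list_comb z (c[j := Suc (c ! j)]) i))
        \<le> \<alpha> * ((\<Sum>i<n. (w i + real (Suc r) * zbar i)\<^sup>2) + real (Suc r) * B)
          - (\<Sum>i<n. \<xi> i * (w i + real (Suc r) * zbar i))"
      using c j by (simp add: list_comb_incr add_ac distrib_right)
  qed (use c in simp)
qed

text \<open>
  Choosing \<open>\<alpha>\<close> by the arithmetic-geometric mean inequality makes the quadratic functional of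
  \<open>list_comb_below_average\<close> a tangent substitute for \<open>\<tau> \<bar>v\<bar> - \<langle>\<xi>, v\<rangle>\<close>, so that
  the bound for sums of \<open>m\<close> members of the family carries over to the convex hull at the cost of
  the variance \<open>B / m\<close>.
\<close>

lemma convex_comb_noise_bound:
  assumes q: "\<And>l. l < N \<Longrightarrow> q l \<ge> 0" "(\<Sum>l<N. q l) = 1"
    and B: "\<And>l. l < N \<Longrightarrow> (\<Sum>i<n. (z l i)\<^sup>2) \<le> B" "B > 0" and m: "m \<ge> 1" and \<tau>: "\<tau> \<ge> 0"
    and noise: "\<And>c. length c = N \<Longrightarrow> sum_list c = m \<Longrightarrow>
      (\<Sum>i<n. \<xi> i * list_comb z c i) \<le> \<tau> * L2_set (list_comb z c) {..<n}"
  defines "zbar \<equiv> \<lambda>i. \<Sum>l<N. q l * z l i"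
  shows "(\<Sum>i<n. \<xi> i * zbar i) \<le> \<tau> * (L2_set zbar {..<n} + sqrt (B / real m))"
proof -
  define R where "R = sqrt ((\<Sum>i<n. (zbar i)\<^sup>2) + B / real m)"
  have R2: "R\<^sup>2 = (\<Sum>i<n. (zbar i)\<^sup>2) + B / real m"
    unfolding R_def using B m by (intro real_sqrt_pow2) (auto intro!: add_nonneg_nonneg sum_nonneg)
  have R: "R > 0" unfolding R_def using B m by (auto intro!: add_nonneg_pos sum_nonneg)
  \<comment> \<open>the bound for the norm of the sum of \<open>m\<close> draws, whereas \<open>R\<close> belongs to their average\<close>
  define \<rho> where "\<rho> = real m * R"
  have \<rho>: "\<rho> > 0" using R m by (simp add: \<rho>_def)
  have \<alpha>: "\<tau> / (2 * \<rho>) \<ge> 0" using \<tau> \<rho> by simp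
  obtain c where c: "length c = N" "sum_list c = m"
    and le: "\<tau> / (2 * \<rho>) * (\<Sum>i<n. (0 + list_comb z c i)\<^sup>2) - (\<Sum>i<n. \<xi> i * (0 + list_comb z c i))
      \<le> \<tau> / (2 * \<rho>) * ((\<Sum>i<n. (0 + real m * zbar i)\<^sup>2) + real m * B) - (\<Sum>i<n. \<xi> i * (0 + real m * zbar i))"
    unfolding zbar_def using list_comb_below_average[where N = N and q = q and z = z and n = n and B = B
        and \<alpha> = "\<tau> / (2 * \<rho>)" and r = m and w = "\<lambda>_. 0" and \<xi> = \<xi>, OF q B(1) \<alpha>] by blast
  let ?V = "L2_set (list_comb z c) {..<n}"
  have V: "(\<Sum>i<n. (list_comb z c i)\<^sup>2) = ?V\<^sup>2" by (simp add: L2_set_def sum_nonneg)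
  have "(\<Sum>i<n. (real m * zbar i)\<^sup>2) + real m * B = \<rho>\<^sup>2"
    using m by (simp add: \<rho>_def power_mult_distrib R2 flip: sum_distrib_left)
       (simp add: power2_eq_square field_simps)
  with le have "real m * (\<Sum>i<n. \<xi> i * zbar i)
      \<le> \<tau> / (2 * \<rho>) * \<rho>\<^sup>2 - \<tau> / (2 * \<rho>) * ?V\<^sup>2 + (\<Sum>i<n. \<xi> i * list_comb z c i)"
    by (simp add: V sum_distrib_left mult_ac)
  also have "\<dots> \<le> \<tau> / (2 * \<rho>) * \<rho>\<^sup>2 - \<tau> / (2 * \<rho>) * ?V\<^sup>2 + \<tau> * ?V"
    using noise[OF c] by simp
  also have "\<dots> = \<tau> * \<rho> - \<tau> / (2 * \<rho>) * (?V - \<rho>)\<^sup>2"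
    using \<rho> by (simp add: field_simps power2_eq_square)
  also have "\<dots> \<le> \<tau> * \<rho>" using \<tau> \<rho> by simp
  also have "\<dots> = real m * (\<tau> * R)" by (simp add: \<rho>_def)
  finally have "(\<Sum>i<n. \<xi> i * zbar i) \<le> \<tau> * R" using m by simp
  also have "R \<le> L2_set zbar {..<n} + sqrt (B / real m)"
    unfolding R_def L2_set_def using B by (intro sqrt_add_le_add_sqrt sum_nonneg) auto
  finally show ?thesis using \<tau> by (simp add: mult_left_mono)
qed

section \<open>The noise bound for a design with bounded columns\<close>

text \<open>
  The columns of \<open>X\<close> followed by their negatives, so that nonnegative weights suffice to represent
  every \<open>X u\<close>.
\<close>

definition signed_column :: "real mat \<Rightarrow> nat \<Rightarrow> nat \<Rightarrow> real" where
  "signed_column X l i =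
    (if l < dim_col X then X $$ (i, l) else - X $$ (i, l - dim_col X))"

definition directions :: "nat \<Rightarrow> nat \<Rightarrow> nat list set" where
  "directions p m = {c. length c = 2 * p \<and> sum_list c = m}"

lemma card_directions: "card (directions p m) = (m + 2 * p - 1) choose m"
  unfolding directions_def by (rule card_length_sum_list)

lemma finite_directions: "finite (directions p m)"
proof (rule finite_subset)
  show "directions p m \<subseteq> {c. set c \<subseteq> {..m} \<and> length c = 2 * p}"
    unfolding directions_def using member_le_sum_list by fastforce
qed (rule finite_lists_length_eq, simp)

lemma power_self_le_exp_fact: "real m ^ m \<le> exp (real m) * fact m"
proof -
  have "(\<Sum>k\<in>{m}. inverse (fact k) *\<^sub>R real m ^ k) \<le> (\<Sum>k. inverse (fact k) *\<^sub>R real m ^ k)"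
    by (intro sum_le_suminf summable_exp_generic) auto
  then have "real m ^ m / fact m \<le> exp (real m)"
    by (simp add: exp_def divide_inverse mult.commute)
  then show ?thesis by (simp add: field_simps)
qed

text \<open>
  Stars and bars together with \<open>m! \<ge> (m / e)\<^sup>m\<close>: the number of directions is at most
  \<open>(4 e p / m)\<^sup>m\<close>. The division by \<open>m!\<close> is essential: counting ordered draws would replace
  \<open>ln (2 e p / m)\<close> by \<open>ln (2 p)\<close> and lose the sharp rate.
\<close>

lemma card_directions_le:
  assumes "1 \<le> m" "m \<le> p"
  shows "real (card (directions p m))
    \<le> exp (real m * (ln (2 * exp 1 * real p / real m) + ln 2))"
proof -
  let ?C = "real ((m + 2 * p - 1) choose m)"
  have "(m + 2 * p - 1) ^ m \<le> (4 * p) ^ m" using assms by (intro power_mono) auto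
  with binomial_fact_pow[of "m + 2 * p - 1" m]
  have "((m + 2 * p - 1) choose m) * fact m \<le> (4 * p) ^ m" by (rule le_trans)
  then have "real (((m + 2 * p - 1) choose m) * fact m) \<le> real ((4 * p) ^ m)"
    by (simp only: of_nat_le_iff)
  then have 1: "?C * fact m \<le> (4 * real p) ^ m" by simp
  have "?C * real m ^ m \<le> ?C * (exp (real m) * fact m)"
    by (intro mult_left_mono power_self_le_exp_fact) auto
  also have "\<dots> \<le> exp (real m) * (4 * real p) ^ m" using 1 by (simp add: mult_ac)
  also have "\<dots> = (exp 1 * (4 * real p)) ^ m"
    by (simp add: power_mult_distrib flip: exp_of_nat_mult)
  finally have "?C \<le> (exp 1 * (4 * real p) / real m) ^ m"
    using assms by (simp add: power_divide field_simps)
  also have "exp 1 * (4 * real p) / real m = exp (ln (2 * exp 1 * real p / real m) + ln 2)"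
    using assms by (simp add: exp_add)
  finally show ?thesis by (simp add: card_directions flip: exp_of_nat_mult)
qed

definition noise_controlled :: "real mat \<Rightarrow> nat \<Rightarrow> real \<Rightarrow> (nat \<Rightarrow> real) \<Rightarrow> bool" where
  "noise_controlled X m \<tau> \<xi> \<longleftrightarrow> (\<forall>c\<in>directions (dim_col X) m.
     (\<Sum>i<dim_row X. \<xi> i * list_comb (signed_column X) c i)
       \<le> \<tau> * L2_set (list_comb (signed_column X) c) {..<dim_row X})"

lemma noise_not_controlled_prob:
  assumes "X \<in> carrier_mat n p" "\<sigma> > 0" "t \<ge> 0"
  shows "{\<xi> \<in> space (noise n \<sigma>). \<not> noise_controlled X m (t * \<sigma>) \<xi>} \<in> sets (noise n \<sigma>)" (is ?A)
    and "measure (noise n \<sigma>) {\<xi> \<in> space (noise n \<sigma>). \<not> noise_controlled X m (t * \<sigma>) \<xi>}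
      \<le> real (card (directions p m)) * exp (- t\<^sup>2 / 2)" (is ?B)
proof -
  let ?v = "list_comb (signed_column X)"
  let ?E = "\<lambda>c. {\<xi> \<in> space (noise n \<sigma>). t * \<sigma> * L2_set (?v c) {..<n} < (\<Sum>i<n. \<xi> i * ?v c i)}"
  interpret P: prob_space "noise n \<sigma>" using assms(2) by (rule prob_space_noise)
  have dims: "dim_row X = n" "dim_col X = p" using assms(1) by auto
  have eq: "{\<xi> \<in> space (noise n \<sigma>). \<not> noise_controlled X m (t * \<sigma>) \<xi>} = (\<Union>c\<in>directions p m. ?E c)"
    unfolding noise_controlled_def dims by (auto simp: not_le)
  have E: "?E c \<in> sets (noise n \<sigma>)" for c
  proof -
    note [measurable] = measurable_noise_linear[where a = "?v c" and n = n and \<sigma> = \<sigma>]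
    show ?thesis by measurable
  qed
  show ?A unfolding eq using E by (intro sets.finite_UN finite_directions) auto
  have "measure (noise n \<sigma>) (\<Union>c\<in>directions p m. ?E c) \<le> (\<Sum>c\<in>directions p m. measure (noise n \<sigma>) (?E c))"
    using E by (intro P.finite_measure_subadditive_finite finite_directions) auto
  also have "\<dots> \<le> (\<Sum>c\<in>directions p m. exp (- t\<^sup>2 / 2))"
    by (intro sum_mono noise_linear_tail assms)
  finally show ?B unfolding eq by simp
qed

lemma sum_lessThan_double:
  fixes f :: "nat \<Rightarrow> real"
  shows "(\<Sum>l<2 * p. f l) = (\<Sum>l<p. f l) + (\<Sum>l<p. f (p + l))"
proof -
  have "(\<Sum>l<p + k. f l) = (\<Sum>l<p. f l) + (\<Sum>l<k. f (p + l))" for k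
    by (induction k) (auto simp: add_ac)
  from this[of p] show ?thesis by (simp add: mult_2)
qed

text \<open>
  The positive and negative parts of \<open>u\<close>, divided by \<open>\<bar>u\<bar>\<^sub>1\<close>, are weights that exhibit
  \<open>X u / \<bar>u\<bar>\<^sub>1\<close> as a convex combination of the signed columns.
\<close>

lemma noise_controlled_bound:
  assumes X: "X \<in> carrier_mat n p" and n: "n \<ge> 1"
    and col: "\<And>j. j < p \<Longrightarrow> (\<Sum>i<n. (X $$ (i, j))\<^sup>2) \<le> real n"
    and m: "m \<ge> 1" and \<tau>: "\<tau> \<ge> 0" and u: "u \<in> carrier_vec p"
    and ctrl: "noise_controlled X m \<tau> \<xi>"
  shows "(\<Sum>i<n. \<xi> i * (X *\<^sub>v u) $ i)
    \<le> \<tau> * (L2_set (\<lambda>i. (X *\<^sub>v u) $ i) {..<n} + l1 u * sqrt (real n / real m))"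
proof (cases "l1 u = 0")
  case True
  then have "u $ j = 0" if "j < p" for j
    using that u by (simp add: l1_def sum_nonneg_eq_0_iff)
  then have "(X *\<^sub>v u) $ i = 0" if "i < n" for i
    using that X u by (simp add: scalar_prod_def)
  then show ?thesis using True \<tau> by (simp add: L2_set_nonneg)
next
  case False
  have dims: "dim_row X = n" "dim_col X = p" "dim_vec u = p" using X u by auto
  have pos: "l1 u > 0" using False by (simp add: l1_def sum_nonneg order_less_le)
  let ?q = "\<lambda>l. (if l < p then max (u $ l) 0 else max (- u $ (l - p)) 0) / l1 u"
  have q1: "?q l \<ge> 0" for l using pos by simp
  have "(\<Sum>l<2 * p. ?q l) = (\<Sum>l<p. (max (u $ l) 0 + max (- u $ l) 0) / l1 u)"
    unfolding sum_lessThan_double by (simp add: add_divide_distrib sum.distrib)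
  also have "\<dots> = (\<Sum>l<p. \<bar>u $ l\<bar>) / l1 u"
    unfolding sum_divide_distrib by (intro sum.cong) (auto simp: max_def)
  finally have q2: "(\<Sum>l<2 * p. ?q l) = 1" using pos by (simp add: l1_def dims)
  have z: "(\<Sum>i<n. (signed_column X l i)\<^sup>2) \<le> real n" if "l < 2 * p" for l
    using that col[of l] col[of "l - p"] by (cases "l < p") (simp_all add: signed_column_def dims)
  have bar: "(\<Sum>l<2 * p. ?q l * signed_column X l i) = (X *\<^sub>v u) $ i / l1 u" if "i < n" for i
  proof -
    have "(\<Sum>l<2 * p. ?q l * signed_column X l i)
        = (\<Sum>l<p. (max (u $ l) 0 - max (- u $ l) 0) * X $$ (i, l) / l1 u)"
      unfolding sum_lessThan_double signed_column_def
      by (simp add: dims left_diff_distrib diff_divide_distrib sum_subtractf sum_negf)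
    also have "\<dots> = (\<Sum>l<p. X $$ (i, l) * u $ l) / l1 u"
      unfolding sum_divide_distrib by (intro sum.cong) (auto simp: max_def)
    also have "(\<Sum>l<p. X $$ (i, l) * u $ l) = (X *\<^sub>v u) $ i"
      using that dims by (simp add: scalar_prod_def lessThan_atLeast0)
    finally show ?thesis .
  qed
  have cb: "(\<Sum>i<n. \<xi> i * list_comb (signed_column X) c i)
      \<le> \<tau> * L2_set (list_comb (signed_column X) c) {..<n}"
    if "length c = 2 * p" "sum_list c = m" for c
    using ctrl that unfolding noise_controlled_def directions_def dims by blast
  have n0: "real n > 0" using n by simp
  have "(\<Sum>i<n. \<xi> i * (\<Sum>l<2 * p. ?q l * signed_column X l i))
      \<le> \<tau> * (L2_set (\<lambda>i. \<Sum>l<2 * p. ?q l * signed_column X l i) {..<n} + sqrt (real n / real m))"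
    by (rule convex_comb_noise_bound[where q = ?q and z = "signed_column X" and N = "2 * p",
          OF q1 q2 z n0 m \<tau> cb])
  also have "L2_set (\<lambda>i. \<Sum>l<2 * p. ?q l * signed_column X l i) {..<n}
      = L2_set (\<lambda>i. (X *\<^sub>v u) $ i / l1 u) {..<n}"
    by (intro L2_set_cong refl bar) simp
  also have "\<dots> = L2_set (\<lambda>i. (X *\<^sub>v u) $ i) {..<n} / l1 u"
    using L2_set_left_distrib[of "inverse (l1 u)" "\<lambda>i. (X *\<^sub>v u) $ i" "{..<n}"] pos
    by (simp add: divide_inverse)
  also have "(\<Sum>i<n. \<xi> i * (\<Sum>l<2 * p. ?q l * signed_column X l i)) = (\<Sum>i<n. \<xi> i * (X *\<^sub>v u) $ i) / l1 u"
    unfolding sum_divide_distrib by (intro sum.cong refl, subst bar) auto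
  finally show ?thesis using pos by (simp add: field_simps)
qed

section \<open>The Gaussian width against the complexity of the sparse model\<close>

text \<open>
  For \<open>m \<le> p / (2 e)\<close> the ratio \<open>2 e p / m\<close> is at least \<open>(2 e)\<^sup>2\<close>. Passing from
  \<open>m\<close> to \<open>m / 2\<close> adds \<open>ln 2\<close> to the logarithm; this lemma makes that addition negligible.
\<close>

lemma ln_complexity_ge:
  assumes "1 \<le> m" "real m \<le> real p / (2 * exp 1)"
  shows "2 + 2 * ln 2 \<le> ln (2 * exp 1 * real p / real m)" "m \<le> p"
proof -
  have m: "real m > 0" using assms by simp
  have e: "2 * exp (1::real) \<ge> 1" using exp_ge_add_one_self[of "1::real"] by linarith
  have "real m * 1 \<le> real m * (2 * exp 1)" using e m by (intro mult_left_mono) auto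
  then show "m \<le> p" using assms(2) by (simp add: field_simps)
  then have p: "real p > 0" using assms by simp
  have "exp 1 \<le> real p / (2 * real m)" using assms m by (simp add: field_simps)
  then have "1 \<le> ln (real p / (2 * real m))" using p m by (subst ln_ge_iff) auto
  then show "2 + 2 * ln 2 \<le> ln (2 * exp 1 * real p / real m)"
    using p m by (simp add: ln_div ln_mult)
qed

text \<open>
  The hypothesis on \<open>m\<close> says \<open>ln (p / (2 m)) \<ge> 1\<close>, and
  \<open>s ln (m / s) \<le> m - s\<close> pays for replacing \<open>s\<close> by \<open>m\<close>. Consequently
  \<open>(2 m / p)\<^bsup>2 m\<^esup> \<le> (2 s / p)\<^bsup>2 s\<^esup>\<close>, so the failure probability at a level \<open>m\<close> above
  the true sparsity is bounded by the one stated for \<open>s\<close>.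
\<close>

lemma mult_ln_ratio_mono:
  assumes "1 \<le> s" "s \<le> m" "real m \<le> real p / (2 * exp 1)"
  shows "real s * ln (real p / (2 * real s)) \<le> real m * ln (real p / (2 * real m))"
proof -
  have m: "real m > 0" "real s > 0" using assms by auto
  have p: "real p > 0" using assms(3) m by (smt (verit) divide_nonpos_pos exp_gt_zero)
  have "exp 1 \<le> real p / (2 * real m)" using assms(3) m by (simp add: field_simps)
  then have 1: "1 \<le> ln (real p / (2 * real m))"
    using p m by (subst ln_ge_iff) auto
  have "ln (real p / (2 * real s)) = ln (real p / (2 * real m)) + ln (real m / real s)"
    using p m by (simp add: ln_div ln_mult)
  moreover have "ln (real m / real s) \<le> real m / real s - 1"
    using m by (intro ln_le_minus_one) auto
  then have "real s * ln (real m / real s) \<le> real m - real s"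
    using mult_left_mono[of "ln (real m / real s)" "real m / real s - 1" "real s"] m
    by (simp add: right_diff_distrib)
  moreover have "real m - real s \<le> (real m - real s) * ln (real p / (2 * real m))"
    using assms(2) 1 mult_left_mono[OF 1, of "real m - real s"] by simp
  ultimately show ?thesis by (simp add: algebra_simps)
qed

text \<open>
  The exponent \<open>t\<^sup>2 / 2 = 25/8 m L\<close> beats the entropy \<open>m (L + ln 2)\<close> of the directions
  with more than \<open>2 m (L - 1 - 2 ln 2) = 2 m ln (p / (2 m))\<close> to spare.
\<close>

lemma noise_not_controlled_le:
  assumes X: "X \<in> carrier_mat n p" and \<sigma>: "\<sigma> > 0"
    and s: "1 \<le> s" "s \<le> m" "real m \<le> real p / (2 * exp 1)"
  defines "t \<equiv> 5 / 2 * sqrt (real m * ln (2 * exp 1 * real p / real m))"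
  shows "measure (noise n \<sigma>) {\<xi> \<in> space (noise n \<sigma>). \<not> noise_controlled X m (t * \<sigma>) \<xi>}
    \<le> (2 * real s / real p) ^ (2 * s)"
proof -
  let ?L = "ln (2 * exp 1 * real p / real m)"
  have "1 \<le> m" using s by simp
  from ln_complexity_ge[OF this s(3)] have L: "?L \<ge> 2 + 2 * ln 2" and "m \<le> p" .
  have mp: "real m > 0" "real p > 0" using s \<open>m \<le> p\<close> by auto
  have ln: "ln (real p / (2 * real m)) = ?L - 1 - 2 * ln 2"
    using mp by (simp add: ln_div ln_mult)
  have l2: "ln (2::real) > 0" by simp
  then have L0: "?L \<ge> 0" using L by linarith
  have t: "t \<ge> 0" "t\<^sup>2 = 25 / 4 * (real m * ?L)"
    using L0 by (auto simp: t_def power_mult_distrib power2_eq_square)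
  have "real m * (?L + ln 2) - t\<^sup>2 / 2 = real m * (ln 2 - 17 / 8 * ?L)"
    unfolding t by (simp add: algebra_simps)
  also have "\<dots> \<le> real m * (- 2 * ln (real p / (2 * real m)))"
  proof (rule mult_left_mono)
    have "b - 17 / 8 * a \<le> - 2 * (a - 1 - 2 * b)" if "a \<ge> 2 + 2 * b" "b > 0" for a b :: real
      using that by (simp add: field_simps)
    from this[OF L l2] show "ln 2 - 17 / 8 * ?L \<le> - 2 * ln (real p / (2 * real m))"
      unfolding ln .
  qed simp
  also have "\<dots> \<le> - 2 * (real s * ln (real p / (2 * real s)))"
    using mult_ln_ratio_mono[OF s] by simp
  also have "\<dots> = real (2 * s) * ln (2 * real s / real p)"
    using mp s by (simp add: ln_div ln_mult algebra_simps)
  finally have expo: "real m * (?L + ln 2) - t\<^sup>2 / 2 \<le> real (2 * s) * ln (2 * real s / real p)" .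
  have "measure (noise n \<sigma>) {\<xi> \<in> space (noise n \<sigma>). \<not> noise_controlled X m (t * \<sigma>) \<xi>}
      \<le> real (card (directions p m)) * exp (- t\<^sup>2 / 2)"
    by (rule noise_not_controlled_prob(2)[OF X \<sigma> t(1)])
  also have "\<dots> \<le> exp (real m * (?L + ln 2)) * exp (- t\<^sup>2 / 2)"
    using s \<open>m \<le> p\<close> by (intro mult_right_mono card_directions_le) auto
  also have "\<dots> = exp (real m * (?L + ln 2) - t\<^sup>2 / 2)" by (simp flip: exp_add)
  also have "\<dots> \<le> exp (real (2 * s) * ln (2 * real s / real p))" using expo by simp
  also have "\<dots> = (2 * real s / real p) ^ (2 * s)"
    using mp s by (simp only: exp_of_nat_mult) simp
  finally show ?thesis .
qed

section \<open>The Lasso under controlled noise\<close>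

lemma emp_norm_eq_L2_set:
  "emp_norm u = L2_set (\<lambda>i. u $ i) {..<dim_vec u} / sqrt (real (dim_vec u))"
  by (simp add: emp_norm_def L2_set_def real_sqrt_divide)

lemma emp_norm_nonneg: "0 \<le> emp_norm u"
  by (simp add: emp_norm_eq_L2_set L2_set_nonneg)

lemma pred_dist_eq_L2_set:
  assumes "X \<in> carrier_mat n p" "u \<in> carrier_vec p" "v \<in> carrier_vec p"
  shows "pred_dist X u v = L2_set (\<lambda>i. (X *\<^sub>v u) $ i - (X *\<^sub>v v) $ i) {..<n} / sqrt (real n)"
  using assms by (simp add: pred_dist_def emp_norm_eq_L2_set mult_minus_distrib_mat_vec
      cong: L2_set_cong_simp)

lemma pred_dist_triangle:
  assumes "X \<in> carrier_mat n p" "u \<in> carrier_vec p" "v \<in> carrier_vec p" "w \<in> carrier_vec p"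
  shows "pred_dist X u w \<le> pred_dist X u v + pred_dist X v w"
proof -
  have "L2_set (\<lambda>i. ((X *\<^sub>v u) $ i - (X *\<^sub>v v) $ i) + ((X *\<^sub>v v) $ i - (X *\<^sub>v w) $ i)) {..<n}
    \<le> L2_set (\<lambda>i. (X *\<^sub>v u) $ i - (X *\<^sub>v v) $ i) {..<n} + L2_set (\<lambda>i. (X *\<^sub>v v) $ i - (X *\<^sub>v w) $ i) {..<n}"
    by (rule L2_set_triangle_ineq)
  then show ?thesis
    using assms by (simp add: pred_dist_eq_L2_set divide_right_mono flip: add_divide_distrib)
qed

lemma pred_dist_commute:
  assumes "X \<in> carrier_mat n p" "u \<in> carrier_vec p" "v \<in> carrier_vec p"
  shows "pred_dist X u v = pred_dist X v u"
  using assms by (simp add: pred_dist_eq_L2_set L2_set_def power2_commute)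

lemma pred_dist_self: "X \<in> carrier_mat n p \<Longrightarrow> u \<in> carrier_vec p \<Longrightarrow> pred_dist X u u = 0"
  by (simp add: pred_dist_eq_L2_set L2_set_def)

text \<open>
  Quotients of norms are nonnegative, so the infimum is over a set that is bounded below.
\<close>

lemma theta_le_quotient:
  assumes "\<delta> \<in> carrier_vec (dim_col X)" "\<delta> \<noteq> 0\<^sub>v (dim_col X)" "l1 \<delta> \<le> (1 + c0) * sqrt s * l2 \<delta>"
  shows "theta X s c0 \<le> emp_norm (X *\<^sub>v \<delta>) / l2 \<delta>"
  unfolding theta_def
proof (rule cINF_lower)
  have "0 \<le> emp_norm (X *\<^sub>v u) / l2 u" for u
    by (simp add: emp_norm_nonneg l2_def sum_nonneg)
  then show "bdd_below ((\<lambda>\<delta>. emp_norm (X *\<^sub>v \<delta>) / l2 \<delta>) `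
      {\<delta> \<in> carrier_vec (dim_col X). \<delta> \<noteq> 0\<^sub>v (dim_col X) \<and> l1 \<delta> \<le> (1 + c0) * sqrt s * l2 \<delta>})"
    by (intro bdd_belowI2[where m = 0])
qed (use assms in simp)

lemma theta_mult_l2_le:
  assumes "X \<in> carrier_mat n p" "\<delta> \<in> carrier_vec p" "l1 \<delta> \<le> (1 + c0) * sqrt s * l2 \<delta>"
  shows "theta X s c0 * l2 \<delta> \<le> emp_norm (X *\<^sub>v \<delta>)"
proof (cases "l2 \<delta> = 0")
  case True
  then show ?thesis by (simp add: emp_norm_nonneg)
next
  case False
  then have "l2 \<delta> > 0" by (simp add: l2_def sum_nonneg order_less_le)
  moreover have "\<delta> \<noteq> 0\<^sub>v p" using False by (auto simp: l2_def)
  ultimately show ?thesis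
    using theta_le_quotient[of \<delta> X c0 s] assms by (simp add: field_simps)
qed

text \<open>
  A single column is a competitor in the infimum. The bound allows terms of the error that come without
  the factor \<open>1 / \<theta>\<close> to be merged with those that have it.
\<close>

lemma theta_le_1:
  assumes X: "X \<in> carrier_mat n p" and p: "p \<ge> 1" and "emp_norm (X *\<^sub>v unit_vec p 0) \<le> 1"
    and "1 \<le> (1 + c0) * sqrt s"
  shows "theta X s c0 \<le> 1"
proof -
  have "(\<Sum>j<p. \<bar>unit_vec p 0 $ j\<bar>) = (\<Sum>j<p. if j = 0 then 1 else (0::real))"
    by (intro sum.cong) (auto simp: unit_vec_def)
  then have l1: "l1 (unit_vec p 0) = 1" using p by (simp add: l1_def)
  have "(\<Sum>j<p. (unit_vec p 0 $ j)\<^sup>2) = (\<Sum>j<p. if j = 0 then 1 else (0::real))"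
    by (intro sum.cong) (auto simp: unit_vec_def)
  then have l2: "l2 (unit_vec p 0) = 1" using p by (simp add: l2_def)
  have "theta X s c0 * l2 (unit_vec p 0) \<le> emp_norm (X *\<^sub>v unit_vec p 0)"
    using X assms by (intro theta_mult_l2_le) (auto simp: l1 l2)
  then show ?thesis using assms(3) by (simp add: l2)
qed

lemma l1_diff_le_support:
  assumes "\<beta> \<in> carrier_vec p" "\<gamma> \<in> carrier_vec p"
  defines "T \<equiv> {j. j < p \<and> \<beta> $ j \<noteq> 0}"
  shows "l1 \<beta> - l1 \<gamma> \<le> (\<Sum>j\<in>T. \<bar>(\<gamma> - \<beta>) $ j\<bar>) - (\<Sum>j\<in>{..<p} - T. \<bar>(\<gamma> - \<beta>) $ j\<bar>)"
proof -
  have T: "T \<subseteq> {..<p}" "finite T" by (auto simp: T_def)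
  have split: "(\<Sum>j<p. f j) = (\<Sum>j\<in>T. f j) + (\<Sum>j\<in>{..<p} - T. f j)" for f :: "nat \<Rightarrow> real"
    using sum.subset_diff[OF T(1), of f] by (simp add: add.commute)
  have "l1 \<beta> - l1 \<gamma> = (\<Sum>j<p. \<bar>\<beta> $ j\<bar> - \<bar>\<gamma> $ j\<bar>)"
    using assms by (simp add: l1_def sum_subtractf)
  also have "\<dots> = (\<Sum>j\<in>T. \<bar>\<beta> $ j\<bar> - \<bar>\<gamma> $ j\<bar>) + (\<Sum>j\<in>{..<p} - T. \<bar>\<beta> $ j\<bar> - \<bar>\<gamma> $ j\<bar>)"
    by (rule split)
  also have "\<dots> \<le> (\<Sum>j\<in>T. \<bar>(\<gamma> - \<beta>) $ j\<bar>) + (\<Sum>j\<in>{..<p} - T. - \<bar>(\<gamma> - \<beta>) $ j\<bar>)"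
    using assms by (intro add_mono sum_mono) (auto simp: T_def)
  finally show ?thesis by (simp add: sum_negf)
qed

lemma sum_abs_le_sqrt_card_l2:
  assumes "T \<subseteq> {..<dim_vec \<delta>}" "card T \<le> m"
  shows "(\<Sum>j\<in>T. \<bar>\<delta> $ j\<bar>) \<le> sqrt (real m) * l2 \<delta>"
proof -
  have "(\<Sum>j\<in>T. \<bar>1\<bar> * \<bar>\<delta> $ j\<bar>) \<le> L2_set (\<lambda>_. 1) T * L2_set (\<lambda>j. \<delta> $ j) T"
    by (rule L2_set_mult_ineq)
  also have "\<dots> \<le> sqrt (real m) * l2 \<delta>"
    using assms unfolding L2_set_def l2_def
    by (intro mult_mono real_sqrt_le_mono sum_mono2) (auto simp: sum_nonneg)
  finally show ?thesis by simp
qed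

text \<open>
  The deterministic core of the Lasso analysis. The roles are: \<open>D\<close> the prediction error,
  \<open>e = \<sigma> sqrt (L / n)\<close>, \<open>S = sqrt m\<close>, \<open>x\<close> and \<open>r\<close> the \<open>l\<^sub>1\<close> masses of the
  estimation error on and off the support, \<open>l\<close> its \<open>l\<^sub>2\<close> norm. If \<open>r \<ge> 7 x\<close>, the penalty
  outweighs the \<open>l\<^sub>1\<close> part of the noise and \<open>D\<close> is at most the confidence term. Otherwise the
  error lies in the cone of \<open>theta\<close> with constant \<open>7\<close>. The upper constants add up to
  \<open>5/2 A + 5\<close>, which \<open>A \<ge> 5\<close> turns into \<open>7/2 A\<close>.
\<close>

lemma oracle_inequality_arith:
  fixes D e S \<theta> A lam x r l :: real
  assumes nn: "D \<ge> 0" "e \<ge> 0" "S \<ge> 0" "x \<ge> 0" "r \<ge> 0" and \<theta>: "0 < \<theta>" "\<theta> \<le> 1" and A: "A \<ge> 5"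
    and lam: "2 * A * e \<le> lam" "lam \<le> 5 / 2 * A * e"
    and x: "x \<le> S * l"
    and basic: "D\<^sup>2 \<le> 5 / 2 * e * (S * D + (x + r)) + lam * (x - r)"
    and cone: "x + r \<le> 8 * (S * l) \<Longrightarrow> \<theta> * l \<le> D"
  shows "D \<le> 7 / 2 * A / \<theta> * (e * S)"
proof -
  have Ae: "5 * e \<le> A * e" using A nn by (intro mult_right_mono) auto
  have AeS: "5 * (e * S) \<le> A * (e * S)" using A nn by (intro mult_right_mono) auto
  have b: "D\<^sup>2 \<le> 5 / 2 * (e * S) * D + (lam + 5 / 2 * e) * x - (lam - 5 / 2 * e) * r"
    using basic by (simp add: algebra_simps add_divide_distrib)
  have goal: "\<theta> * D \<le> 7 / 2 * A * (e * S)"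
  proof (cases "D = 0")
    case True
    then show ?thesis using A nn by simp
  next
    case False
    then have D: "D > 0" using nn by simp
    show ?thesis
    proof (cases "7 * x \<le> r")
      case True
      have "(lam + 5 / 2 * e) * x \<le> (lam + 5 / 2 * e) * (r / 7)"
        using True Ae lam nn by (intro mult_left_mono) auto
      also have "\<dots> \<le> (lam - 5 / 2 * e) * r"
      proof -
        have "(lam + 5 / 2 * e) / 7 * r \<le> (lam - 5 / 2 * e) * r"
          using Ae lam nn by (intro mult_right_mono) auto
        then show ?thesis by simp
      qed
      finally have "D * D \<le> 5 / 2 * (e * S) * D" using b by (simp add: power2_eq_square)
      then have "D \<le> 5 / 2 * (e * S)" using D by simp
      moreover have "\<theta> * D \<le> D" using \<theta> D by simp
      ultimately show ?thesis using AeS nn by simp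
    next
      case False
      then have lD: "\<theta> * l \<le> D" using x by (intro cone) linarith
      have "0 \<le> (lam - 5 / 2 * e) * r" using Ae lam nn by (intro mult_nonneg_nonneg) auto
      with b have "D\<^sup>2 \<le> 5 / 2 * (e * S) * D + (lam + 5 / 2 * e) * x" by linarith
      also have "(lam + 5 / 2 * e) * x \<le> (5 / 2 * A * e + 5 / 2 * e) * (S * l)"
        using x lam nn Ae by (intro mult_mono) auto
      finally have "D\<^sup>2 \<le> 5 / 2 * (e * S) * D + (5 / 2 * A * e + 5 / 2 * e) * (S * l)" by simp
      then have "\<theta> * D\<^sup>2 \<le> \<theta> * (5 / 2 * (e * S) * D + (5 / 2 * A * e + 5 / 2 * e) * (S * l))"
        using \<theta> by (intro mult_left_mono) auto
      also have "\<dots> = \<theta> * (5 / 2 * (e * S) * D) + (5 / 2 * A + 5 / 2) * (e * S) * (\<theta> * l)"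
        by (simp add: algebra_simps)
      also have "\<dots> \<le> 1 * (5 / 2 * (e * S) * D) + (5 / 2 * A + 5 / 2) * (e * S) * D"
        using \<theta> nn D A lD by (intro add_mono mult_right_mono mult_left_mono) auto
      finally have "(\<theta> * D) * D \<le> (5 / 2 * A + 5) * (e * S) * D"
        by (simp add: power2_eq_square algebra_simps)
      then have "\<theta> * D \<le> (5 / 2 * A + 5) * (e * S)" using D by simp
      then show ?thesis using AeS by (simp add: algebra_simps)
    qed
  qed
  then show ?thesis using \<theta> by (simp add: field_simps)
qed

text \<open>
  Tuning for \<open>b\<close> is, up to the factor \<open>5/4\<close>, tuning for any level \<open>m\<close> between \<open>b\<close> and
  \<open>2 b\<close>, since the tuning parameter depends on the level only through a logarithm.
\<close>

lemma lasso_tuning_bounds: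
  assumes "X \<in> carrier_mat n p" "\<sigma> > 0" "1 \<le> b" "b \<le> m" "m \<le> 2 * b" "real m \<le> real p / (2 * exp 1)"
  defines "e \<equiv> \<sigma> * sqrt (ln (2 * exp 1 * real p / real m) / real n)"
  shows "2 * (4 + sqrt 2) * e \<le> lasso_tuning X \<sigma> b"
    and "lasso_tuning X \<sigma> b \<le> 5 / 2 * (4 + sqrt 2) * e"
proof -
  let ?L = "ln (2 * exp 1 * real p / real m)" and ?Lb = "ln (2 * exp 1 * real p / real b)"
  have L: "2 + 2 * ln 2 \<le> ?L" "m \<le> p" using ln_complexity_ge[of m p] assms by auto
  have pos: "real p > 0" "real m > 0" "real b > 0" using assms L by auto
  have ln: "ln (2 * exp 1 * real p / x) = ln 2 + 1 + ln (real p) - ln x" if "x > 0" for x :: real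
    using that pos by (simp add: ln_div ln_mult)
  have "ln (real m) \<le> ln (2 * real b)" using assms(5) pos by simp
  also have "\<dots> = ln 2 + ln (real b)" using pos by (simp add: ln_mult)
  finally have Lb: "?L \<le> ?Lb" "?Lb \<le> ?L + ln 2"
    using assms(4) pos ln[of "real m"] ln[of "real b"] by auto
  have l2: "0 < ln (2::real)" by simp
  have "?Lb \<le> 25 / 16 * ?L" using Lb L l2 by linarith
  then have "sqrt (?Lb / real n) \<le> sqrt ((5 / 4)\<^sup>2 * (?L / real n))"
    using divide_right_mono[of ?Lb "25 / 16 * ?L" "real n"]
    by (intro real_sqrt_le_mono) (simp add: power2_eq_square)
  then have u: "sqrt (?Lb / real n) \<le> 5 / 4 * sqrt (?L / real n)"
    by (simp only: real_sqrt_mult real_sqrt_abs)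
  have l: "sqrt (?L / real n) \<le> sqrt (?Lb / real n)"
    using Lb by (intro real_sqrt_le_mono divide_right_mono) auto
  have A: "0 \<le> 2 * (4 + sqrt 2) * \<sigma>" using assms by simp
  have tun: "lasso_tuning X \<sigma> b = 2 * (4 + sqrt 2) * \<sigma> * sqrt (?Lb / real n)"
    using assms(1) by (simp add: lasso_tuning_def)
  show "2 * (4 + sqrt 2) * e \<le> lasso_tuning X \<sigma> b"
    using mult_left_mono[OF l A] by (simp add: tun e_def mult_ac)
  show "lasso_tuning X \<sigma> b \<le> 5 / 2 * (4 + sqrt 2) * e"
  proof -
    have "2 * (4 + sqrt 2) * \<sigma> * (5 / 4 * w) = 5 / 2 * (4 + sqrt 2) * (\<sigma> * w)" for w
      by (simp add: algebra_simps)
    then show ?thesis using mult_left_mono[OF u A] by (simp only: tun e_def)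
  qed
qed

text \<open>
  The first-order condition of the Lasso, compared with the true vector. In contrast to comparing the values of
  the objective, it yields the squared error with coefficient one and the noise term without the factor two.
\<close>

lemma lasso_basic_inequality:
  assumes X: "X \<in> carrier_mat n p" and n: "n \<ge> 1" and \<beta>: "\<beta> \<in> carrier_vec p"
    and tun: "lasso_tuning X \<sigma> b \<ge> 0"
    and las: "is_lasso X \<sigma> b (X *\<^sub>v \<beta> + vec n \<xi>) \<gamma>"
  shows "(pred_dist X \<gamma> \<beta>)\<^sup>2
    \<le> (\<Sum>i<n. \<xi> i * (X *\<^sub>v (\<gamma> - \<beta>)) $ i) / real n + lasso_tuning X \<sigma> b * (l1 \<beta> - l1 \<gamma>)"
proof -
  have \<gamma>: "\<gamma> \<in> carrier_vec p" using las X unfolding is_lasso_def is_arg_min_def by auto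
  let ?d = "\<lambda>i. (X *\<^sub>v \<gamma>) $ i - (X *\<^sub>v \<beta>) $ i"
  have d: "(X *\<^sub>v (\<gamma> - \<beta>)) $ i = ?d i" if "i < n" for i
    using that X \<gamma> \<beta> by (simp add: mult_minus_distrib_mat_vec)
  have "(\<Sum>i<n. ((X *\<^sub>v \<gamma>) $ i - (X *\<^sub>v \<beta> + vec n \<xi>) $ i) * ((X *\<^sub>v \<beta>) $ i - (X *\<^sub>v \<gamma>) $ i))
      = (\<Sum>i<n. \<xi> i * ?d i - (?d i)\<^sup>2)"
    using X by (intro sum.cong) (auto simp: power2_eq_square algebra_simps)
  also have "\<dots> = (\<Sum>i<n. \<xi> i * ?d i) - (\<Sum>i<n. (?d i)\<^sup>2)" by (rule sum_subtractf)
  finally have "(\<Sum>i<n. (?d i)\<^sup>2) / real n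
      \<le> (\<Sum>i<n. \<xi> i * ?d i) / real n + lasso_tuning X \<sigma> b * (l1 \<beta> - l1 \<gamma>)"
    using is_lasso_first_order[OF X n _ tun las \<beta>] X \<beta> by (simp add: diff_divide_distrib)
  moreover have "(pred_dist X \<gamma> \<beta>)\<^sup>2 = (\<Sum>i<n. (?d i)\<^sup>2) / real n"
    using X \<gamma> \<beta> by (simp add: pred_dist_eq_L2_set L2_set_def power_divide sum_nonneg)
  moreover have "(\<Sum>i<n. \<xi> i * (X *\<^sub>v (\<gamma> - \<beta>)) $ i) = (\<Sum>i<n. \<xi> i * ?d i)"
    by (intro sum.cong) (simp_all add: d)
  ultimately show ?thesis by simp
qed

text \<open>
  Here \<open>k\<close> is the sparsity level of the restricted eigenvalue. The tuning level \<open>b\<close> may lie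
  below the sparsity of \<open>\<beta>\<close>, but not by more than a factor two.
\<close>

lemma lasso_error_le_rate:
  assumes X: "X \<in> carrier_mat n p" and n: "n \<ge> 1" and \<sigma>: "\<sigma> > 0"
    and col: "\<And>j. j < p \<Longrightarrow> (\<Sum>i<n. (X $$ (i, j))\<^sup>2) \<le> real n"
    and \<beta>: "\<beta> \<in> carrier_vec p" "l0 \<beta> \<le> m"
    and b: "1 \<le> b" "b \<le> m" "m \<le> 2 * b" and m: "real m \<le> real p / (2 * exp 1)" "real m \<le> k"
    and \<theta>: "0 < theta X k 7" "theta X k 7 \<le> 1"
    and ctrl: "noise_controlled X m (5 / 2 * sqrt (real m * ln (2 * exp 1 * real p / real m)) * \<sigma>) \<xi>"
    and las: "is_lasso X \<sigma> b (X *\<^sub>v \<beta> + vec n \<xi>) \<gamma>"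
  shows "pred_dist X \<gamma> \<beta> \<le> rate X \<sigma> (7 * (4 + sqrt 2) / (2 * theta X k 7)) (real m)"
proof -
  let ?L = "ln (2 * exp 1 * real p / real m)"
  let ?D = "pred_dist X \<gamma> \<beta>" and ?\<delta> = "\<gamma> - \<beta>"
  define e where "e = \<sigma> * sqrt (?L / real n)"
  define T where "T = {j. j < p \<and> \<beta> $ j \<noteq> 0}"
  define x where "x = (\<Sum>j\<in>T. \<bar>?\<delta> $ j\<bar>)"
  define r where "r = (\<Sum>j\<in>{..<p} - T. \<bar>?\<delta> $ j\<bar>)"
  have \<gamma>: "\<gamma> \<in> carrier_vec p" using las X unfolding is_lasso_def is_arg_min_def by auto
  have \<delta>: "?\<delta> \<in> carrier_vec p" using \<gamma> \<beta> by simp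
  have l2: "0 < ln (2::real)" by simp
  have "1 \<le> m" using b by simp
  from ln_complexity_ge[OF this m(1)] have L: "?L \<ge> 0" and mp: "m \<le> p" using l2 by linarith+
  have m0: "real m > 0" and n0: "real n > 0" using b n by auto
  have e0: "e \<ge> 0" using \<sigma> L by (simp add: e_def)
  note lam = lasso_tuning_bounds[OF X \<sigma> b m(1), folded e_def]
  have tun: "lasso_tuning X \<sigma> b \<ge> 0" using b mp X \<sigma> by (intro lasso_tuning_nonneg) auto
  have l1\<delta>: "l1 ?\<delta> = x + r"
    using sum.subset_diff[of T "{..<p}" "\<lambda>j. \<bar>?\<delta> $ j\<bar>"] \<delta> \<beta>
    by (simp add: l1_def x_def r_def T_def subset_eq add.commute)
  have xl: "x \<le> sqrt (real m) * l2 ?\<delta>"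
    unfolding x_def using \<beta> \<gamma> by (intro sum_abs_le_sqrt_card_l2) (auto simp: T_def l0_def)
  have D: "?D = L2_set (\<lambda>i. (X *\<^sub>v ?\<delta>) $ i) {..<n} / sqrt (real n)"
    using X by (simp add: pred_dist_def emp_norm_eq_L2_set)
  have noise: "(\<Sum>i<n. \<xi> i * (X *\<^sub>v ?\<delta>) $ i) / real n \<le> 5 / 2 * e * (sqrt (real m) * ?D + (x + r))"
  proof -
    have "(\<Sum>i<n. \<xi> i * (X *\<^sub>v ?\<delta>) $ i)
        \<le> 5 / 2 * sqrt (real m * ?L) * \<sigma> *
          (L2_set (\<lambda>i. (X *\<^sub>v ?\<delta>) $ i) {..<n} + l1 ?\<delta> * sqrt (real n / real m))"
      using \<sigma> L b by (intro noise_controlled_bound[OF X n col _ _ \<delta> ctrl]) auto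
    also have "L2_set (\<lambda>i. (X *\<^sub>v ?\<delta>) $ i) {..<n} = sqrt (real n) * ?D" using n0 by (simp add: D)
    finally have "(\<Sum>i<n. \<xi> i * (X *\<^sub>v ?\<delta>) $ i)
        \<le> 5 / 2 * sqrt (real m * ?L) * \<sigma> * (sqrt (real n) * ?D + (x + r) * sqrt (real n / real m))"
      by (simp only: l1\<delta>)
    then have "(\<Sum>i<n. \<xi> i * (X *\<^sub>v ?\<delta>) $ i) / real n
        \<le> 5 / 2 * sqrt (real m * ?L) * \<sigma> * (sqrt (real n) * ?D + (x + r) * sqrt (real n / real m)) / real n"
      by (rule divide_right_mono) simp
    also have "\<dots> = 5 / 2 * e * (sqrt (real m) * ?D + (x + r))"
    proof -
      define sm sn sl where "sm = sqrt (real m)" and "sn = sqrt (real n)" and "sl = sqrt ?L"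
      have "real n = sn * sn" "sm > 0" "sn > 0" using n0 m0 by (auto simp: sn_def sm_def)
      then show ?thesis
        by (simp add: e_def real_sqrt_mult real_sqrt_divide flip: sm_def sn_def sl_def)
           (simp add: field_simps)
    qed
    finally show ?thesis .
  qed
  have "(?D)\<^sup>2 \<le> (\<Sum>i<n. \<xi> i * (X *\<^sub>v ?\<delta>) $ i) / real n + lasso_tuning X \<sigma> b * (l1 \<beta> - l1 \<gamma>)"
    by (rule lasso_basic_inequality[OF X n \<beta>(1) tun las])
  also have "\<dots> \<le> 5 / 2 * e * (sqrt (real m) * ?D + (x + r)) + lasso_tuning X \<sigma> b * (x - r)"
    using l1_diff_le_support[OF \<beta>(1) \<gamma>] tun
    by (intro add_mono noise mult_left_mono) (auto simp: x_def r_def T_def)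
  finally have basic: "(?D)\<^sup>2 \<le> 5 / 2 * e * (sqrt (real m) * ?D + (x + r)) + lasso_tuning X \<sigma> b * (x - r)" .
  have cone: "theta X k 7 * l2 ?\<delta> \<le> ?D" if "x + r \<le> 8 * (sqrt (real m) * l2 ?\<delta>)"
  proof -
    have "sqrt (real m) * l2 ?\<delta> \<le> sqrt k * l2 ?\<delta>"
      using m by (intro mult_right_mono) (auto simp: l2_def sum_nonneg)
    then have "l1 ?\<delta> \<le> (1 + 7) * sqrt k * l2 ?\<delta>" using that by (simp add: l1\<delta>)
    then show ?thesis unfolding pred_dist_def by (rule theta_mult_l2_le[OF X \<delta>])
  qed
  have "?D \<le> 7 / 2 * (4 + sqrt 2) / theta X k 7 * (e * sqrt (real m))"
    using basic cone xl lam \<theta> e0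
    by (intro oracle_inequality_arith[where x = x and r = r and l = "l2 ?\<delta>"])
       (auto simp: x_def r_def sum_nonneg pred_dist_def emp_norm_nonneg)
  also have "\<dots> = rate X \<sigma> (7 * (4 + sqrt 2) / (2 * theta X k 7)) (real m)"
    using X by (simp add: rate_def e_def real_sqrt_mult real_sqrt_divide mult_ac)
  finally show ?thesis .
qed

section \<open>The selected sparsity level\<close>

lemma grid_Suc: "1 \<le> k \<Longrightarrow> grid (Suc k) = 2 * grid k"
  by (cases k) (simp_all add: grid_def)

lemma grid_ge_1: "1 \<le> grid k"
  by (simp add: grid_def)

lemma grid_mono: "j \<le> k \<Longrightarrow> grid j \<le> grid k"
  unfolding grid_def by (intro power_increasing) auto

lemma less_grid_Suc_grid_max:
  assumes "2 \<le> sstar"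
  shows "sstar < grid (Suc (grid_max sstar))"
proof (rule ccontr)
  assume "\<not> sstar < grid (Suc (grid_max sstar))"
  then have mem: "Suc (grid_max sstar) \<in> {m. 1 \<le> m \<and> grid m \<le> sstar}" by simp
  have "m \<le> Suc sstar" if "m \<in> {m. 1 \<le> m \<and> grid m \<le> sstar}" for m
  proof -
    have "2 ^ (m - 1) \<le> sstar" using that by (simp add: grid_def)
    with less_exp[of "m - 1"] have "m - 1 < sstar" by (rule less_le_trans)
    then show ?thesis by simp
  qed
  then have "finite {m. 1 \<le> m \<and> grid m \<le> sstar}"
    by (auto intro: finite_subset[of _ "{..Suc sstar}"])
  from Max_ge[OF this mem] show False unfolding grid_max_def by simp
qed

lemma m_hat_le:
  assumes "2 \<le> K" "K \<le> grid_max sstar"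
    and "\<And>k. K \<le> k \<Longrightarrow> k \<le> grid_max sstar \<Longrightarrow>
      pred_dist X (\<beta>h (grid k) y) (\<beta>h (grid (k - 1)) y) \<le> 2 * rate X \<sigma> C0 (grid k)"
  shows "m_hat X \<sigma> C0 sstar \<beta>h y \<le> K"
proof -
  let ?A = "{m \<in> {2..grid_max sstar}. \<forall>k\<in>{m..grid_max sstar}.
    pred_dist X (\<beta>h (grid k) y) (\<beta>h (grid (k - 1)) y) \<le> 2 * rate X \<sigma> C0 (grid k)}"
  have K: "K \<in> ?A" using assms by simp
  then have "Min ?A \<le> K" by (intro Min_le) auto
  then show ?thesis using K unfolding m_hat_def Let_def by (simp only: if_False split: if_split) blast
qed

text \<open>
  If no index passes all tests, the selected index is the last one, and there is nothing above it to
  compare.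
\<close>

lemma pred_dist_le_above_m_hat:
  assumes "m_hat X \<sigma> C0 sstar \<beta>h y < k" "k \<le> grid_max sstar"
  shows "pred_dist X (\<beta>h (grid k) y) (\<beta>h (grid (k - 1)) y) \<le> 2 * rate X \<sigma> C0 (grid k)"
proof -
  let ?A = "{m \<in> {2..grid_max sstar}. \<forall>k\<in>{m..grid_max sstar}.
    pred_dist X (\<beta>h (grid k) y) (\<beta>h (grid (k - 1)) y) \<le> 2 * rate X \<sigma> C0 (grid k)}"
  show ?thesis
  proof (cases "?A = {}")
    case True
    then have "m_hat X \<sigma> C0 sstar \<beta>h y = grid_max sstar"
      unfolding m_hat_def Let_def by simp
    then show ?thesis using assms by simp
  next
    case False
    have mem: "Min ?A \<in> ?A" by (rule Min_in[OF _ False]) simp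
    have eq: "m_hat X \<sigma> C0 sstar \<beta>h y = Min ?A"
      using False unfolding m_hat_def Let_def by (simp only: if_False)
    have "m_hat X \<sigma> C0 sstar \<beta>h y \<in> ?A" using mem unfolding eq .
    then have "\<forall>k\<in>{m_hat X \<sigma> C0 sstar \<beta>h y..grid_max sstar}.
        pred_dist X (\<beta>h (grid k) y) (\<beta>h (grid (k - 1)) y) \<le> 2 * rate X \<sigma> C0 (grid k)"
      by blast
    then show ?thesis by (rule bspec) (use assms in simp)
  qed
qed

lemma rate_le_scaled:
  assumes "0 \<le> c * \<sigma>" "0 \<le> C"
    and "a * ln (2 * exp 1 * real (dim_col X) / a) \<le> C\<^sup>2 * (b * ln (2 * exp 1 * real (dim_col X) / b))"
  shows "rate X \<sigma> c a \<le> C * rate X \<sigma> c b"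
proof -
  let ?f = "\<lambda>b. b * ln (2 * exp 1 * real (dim_col X) / b)" and ?n = "real (dim_row X)"
  have "sqrt (?f a / ?n) \<le> sqrt (C\<^sup>2 * (?f b / ?n))"
    using divide_right_mono[OF assms(3), of ?n] by (intro real_sqrt_le_mono) simp
  also have "\<dots> = C * sqrt (?f b / ?n)" using assms(2) by (simp only: real_sqrt_mult real_sqrt_abs abs_of_nonneg)
  finally have "c * \<sigma> * sqrt (?f a / ?n) \<le> c * \<sigma> * (C * sqrt (?f b / ?n))"
    using assms(1) by (rule mult_left_mono)
  then show ?thesis by (simp add: rate_def mult_ac)
qed

lemma ln_complexity_double:
  assumes "1 \<le> b" "p \<ge> 1"
  shows "ln (2 * exp 1 * real p / real b) = ln (2 * exp 1 * real p / real (2 * b)) + ln 2"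
  using assms by (simp add: ln_div ln_mult)

text \<open>
  The constant: \<open>1/2 (1 + ln 2 / L) \<le> 16/25\<close> for \<open>L \<ge> 2 + 2 ln 2\<close>. Any constant
  below \<open>1\<close> would make the rates along the grid summable.
\<close>

lemma rate_half_le:
  assumes "X \<in> carrier_mat n p" "0 \<le> c * \<sigma>" "1 \<le> b" "real (2 * b) \<le> real p / (2 * exp 1)"
  shows "rate X \<sigma> c (real b) \<le> 4 / 5 * rate X \<sigma> c (real (2 * b))"
proof (rule rate_le_scaled)
  let ?L = "ln (2 * exp 1 * real p / real (2 * b))"
  have L: "2 + 2 * ln 2 \<le> ?L" "2 * b \<le> p" using ln_complexity_ge[of "2 * b" p] assms by auto
  have l2: "0 < ln (2::real)" by simp
  have "25 * ln 2 \<le> 7 * ?L" using L(1) l2 ln_2_less_1 by linarith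
  then have "?L + ln 2 \<le> 32 / 25 * ?L" by simp
  then have "real b * (?L + ln 2) \<le> real b * (32 / 25 * ?L)" by (rule mult_left_mono) simp
  then show "real b * ln (2 * exp 1 * real (dim_col X) / real b)
      \<le> (4 / 5)\<^sup>2 * (real (2 * b) * ln (2 * exp 1 * real (dim_col X) / real (2 * b)))"
    using assms(1,3) L(2) ln_complexity_double[of b p] by (simp add: power2_eq_square)
qed (use assms in auto)

lemma rate_comparable:
  assumes "X \<in> carrier_mat n p" "0 \<le> c * \<sigma>" "1 \<le> a" "1 \<le> b" "a \<le> 2 * b" "b \<le> 2 * a"
    and "real b \<le> real p / (2 * exp 1)"
  shows "rate X \<sigma> c (real a) \<le> 2 * rate X \<sigma> c (real b)"
proof (rule rate_le_scaled)
  let ?L = "\<lambda>b. ln (2 * exp 1 * real p / real b)"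
  have L: "2 + 2 * ln 2 \<le> ?L b" "b \<le> p" using ln_complexity_ge[of b p] assms by auto
  have l2: "0 < ln (2::real)" by simp
  have pos: "real p > 0" "real a > 0" "real b > 0" using assms L by auto
  have "ln (real b) \<le> ln (2 * real a)" using pos assms(6) by simp
  then have "?L a \<le> ?L b + ln 2" using pos by (simp add: ln_div ln_mult)
  then have "?L a \<le> 2 * ?L b" using L(1) l2 by linarith
  then have "real a * ?L a \<le> real a * (2 * ?L b)" by (rule mult_left_mono) simp
  also have "\<dots> \<le> (2 * real b) * (2 * ?L b)"
    using assms(5) L(1) l2 by (intro mult_right_mono) linarith+
  finally show "real a * ln (2 * exp 1 * real (dim_col X) / real a)
      \<le> 2\<^sup>2 * (real b * ln (2 * exp 1 * real (dim_col X) / real b))"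
    using assms(1) by simp
qed (use assms in auto)

lemma rate_pos:
  assumes "X \<in> carrier_mat n p" "n \<ge> 1" "0 < c * \<sigma>" "1 \<le> b" "real b \<le> real p / (2 * exp 1)"
  shows "0 < rate X \<sigma> c (real b)"
proof -
  have l2: "0 < ln (2::real)" by simp
  have "0 < ln (2 * exp 1 * real p / real b)" using ln_complexity_ge(1)[of b p] assms l2 by linarith
  then have "0 < sqrt (real b * ln (2 * exp 1 * real (dim_col X) / real b) / real (dim_row X))"
    using assms by simp
  then show ?thesis unfolding rate_def by (rule mult_pos_pos[OF assms(3)])
qed

text \<open>
  The levels at which the noise has to be controlled: the grid points above \<open>s\<close>, and \<open>s\<close> itself
  for the case that it exceeds the whole grid, in which it is still less than twice the last grid point.
\<close>

definition levels :: "nat \<Rightarrow> nat \<Rightarrow> nat set" where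
  "levels sstar s = insert s (grid ` {k. 2 \<le> k \<and> k \<le> grid_max sstar \<and> s \<le> grid k})"

lemma finite_levels: "finite (levels sstar s)"
  unfolding levels_def by (intro finite.insertI finite_imageI) (auto intro: finite_subset[of _ "{..grid_max sstar}"])

lemma card_levels_le:
  assumes "2 \<le> sstar"
  shows "card (levels sstar s) \<le> grid_max sstar"
proof -
  have "card (levels sstar s) \<le> card (insert s (grid ` {2..grid_max sstar}))"
    unfolding levels_def by (intro card_mono) auto
  also have "\<dots> \<le> Suc (card (grid ` {2..grid_max sstar}))" by (rule card_insert_le_m1) simp_all
  also have "\<dots> \<le> Suc (card {2..grid_max sstar})" by (intro Suc_le_mono[THEN iffD2] card_image_le) simp
  also have "\<dots> = grid_max sstar" using grid_max(1)[OF assms] by simp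
  finally show ?thesis .
qed

lemma levels_bounds:
  assumes "2 \<le> sstar" "s \<in> {1..sstar}" "m \<in> levels sstar s"
  shows "s \<le> m" "m \<le> sstar"
  using assms grid_max(2)[OF assms(1)] by (auto simp: levels_def)

text \<open>
  The deterministic part of the selection argument, for fits that are accurate at all levels.
  Let \<open>K \<ge> 2\<close> be the first index whose grid point reaches \<open>s\<close>, or the last index if there is
  none. In the first case every comparison from \<open>K\<close> on passes, so in both cases the selected index is at most \<open>K\<close>. The error
  is then at most \<open>10 rate (grid K)\<close> for the chain from the selected fit to the one at \<open>K\<close>, plus the error of the
  latter, and both rates are within a factor two of \<open>rate s\<close>: altogether \<open>22 rate s\<close>.
\<close>

lemma selection_of_accurate_fits:
  assumes X: "X \<in> carrier_mat n p" and n: "n \<ge> 1" and C0: "0 < C0 * \<sigma>"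
    and ss: "2 \<le> sstar" "real sstar \<le> real p / (2 * exp 1)" and s: "s \<in> {1..sstar}"
    and \<beta>: "\<beta> \<in> carrier_vec p" and \<beta>h: "\<And>b. 1 \<le> b \<Longrightarrow> b \<le> p \<Longrightarrow> \<beta>h b y \<in> carrier_vec p"
    and acc: "\<And>m b. m \<in> levels sstar s \<Longrightarrow> 1 \<le> b \<Longrightarrow> b \<le> m \<Longrightarrow> m \<le> 2 * b \<Longrightarrow>
      pred_dist X (\<beta>h b y) \<beta> \<le> rate X \<sigma> C0 (real m)"
  shows "s_hat X \<sigma> C0 sstar \<beta>h y \<le> s"
    and "pred_dist X (beta_tilde X \<sigma> C0 sstar \<beta>h y) \<beta> < 23 * rate X \<sigma> C0 (real s)"
proof -
  let ?M = "grid_max sstar" and ?m = "m_hat X \<sigma> C0 sstar \<beta>h y"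
  let ?w = "\<lambda>b. rate X \<sigma> C0 (real b)" and ?g = "\<lambda>k. \<beta>h (grid k) y"
  note m = m_hat_bounds[OF ss(1), of X \<sigma> C0 \<beta>h y]
  have "sstar \<le> p" using ln_complexity_ge(2)[of sstar p] ss by simp
  then have gp: "grid k \<le> p" if "1 \<le> k" "k \<le> ?M" for k
    using grid_max(2)[OF ss(1) that] by simp
  have gc: "?g k \<in> carrier_vec p" if "1 \<le> k" "k \<le> ?M" for k
    using \<beta>h[OF grid_ge_1 gp[OF that]] .
  have small: "real b \<le> real p / (2 * exp 1)" if "b \<le> sstar" for b
    using that ss(2) by (meson of_nat_le_iff order_trans)
  have C0': "0 \<le> C0 * \<sigma>" using C0 by simp
  have step: "pred_dist X (?g k) (?g (k - 1)) \<le> 2 * ?w (grid k)"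
    if k: "2 \<le> k" "k \<le> ?M" "s \<le> grid k" for k
  proof -
    have lev: "grid k \<in> levels sstar s" using k by (auto simp: levels_def)
    have "1 \<le> k - 1" "k - 1 \<le> ?M" "1 \<le> k" using k by auto
    note c = gc[OF this(1,2)] gc[OF this(3) k(2)]
    have gk: "grid k = 2 * grid (k - 1)" using grid_Suc[OF \<open>1 \<le> k - 1\<close>] k by simp
    have "pred_dist X (?g k) (?g (k - 1)) \<le> pred_dist X (?g k) \<beta> + pred_dist X \<beta> (?g (k - 1))"
      by (rule pred_dist_triangle[OF X c(2) \<beta> c(1)])
    also have "pred_dist X \<beta> (?g (k - 1)) = pred_dist X (?g (k - 1)) \<beta>"
      by (rule pred_dist_commute[OF X \<beta> c(1)])
    also have "pred_dist X (?g k) \<beta> + \<dots> \<le> ?w (grid k) + ?w (grid k)"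
      using grid_ge_1[of k] grid_ge_1[of "k - 1"] gk by (intro add_mono acc[OF lev]) auto
    finally show ?thesis by simp
  qed
  \<comment> \<open>\<open>10\<close> is the sum of the geometric series: \<open>10 * 4/5 + 2 = 10\<close>\<close>
  have chain: "pred_dist X (?g ?m) (?g k) \<le> 10 * ?w (grid k)" if "?m \<le> k" "k \<le> ?M" for k
    using that
  proof (induction k rule: dec_induct)
    case base
    have "?m \<ge> 1" using m by simp
    from gc[OF this m(2)] grid_max(2)[OF ss(1) this m(2)] show ?case
      using rate_pos[OF X n C0 grid_ge_1 small] by (simp add: pred_dist_self[OF X] less_imp_le)
  next
    case (step k)
    have k: "1 \<le> k" "k \<le> ?M" "1 \<le> Suc k" "Suc k \<le> ?M" "1 \<le> ?m" using step m by auto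
    note c = gc[OF k(1,2)] gc[OF k(3,4)] gc[OF k(5) m(2)]
    have "pred_dist X (?g ?m) (?g (Suc k)) \<le> pred_dist X (?g ?m) (?g k) + pred_dist X (?g k) (?g (Suc k))"
      by (rule pred_dist_triangle[OF X c(3,1,2)])
    also have "pred_dist X (?g k) (?g (Suc k)) = pred_dist X (?g (Suc k)) (?g (Suc k - 1))"
      using pred_dist_commute[OF X c(1,2)] by simp
    also have "pred_dist X (?g ?m) (?g k) + \<dots> \<le> 10 * ?w (grid k) + 2 * ?w (grid (Suc k))"
      using step k by (intro add_mono pred_dist_le_above_m_hat) auto
    also have "?w (grid k) \<le> 4 / 5 * ?w (grid (Suc k))"
      using small[OF grid_max(2)[OF ss(1) k(3,4)]] unfolding grid_Suc[OF k(1)]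
      by (intro rate_half_le[OF X C0' grid_ge_1])
    finally show ?case by simp
  qed
  \<comment> \<open>\<open>K\<close> is the index of the reference fit and \<open>l\<close> the level at which its accuracy is used\<close>
  obtain K l where K: "2 \<le> K" "K \<le> ?M" "?m \<le> K" "grid (?m - 1) \<le> s"
    and l: "l \<in> levels sstar s" "grid K \<le> l" "l \<le> 2 * grid K" "l \<le> 2 * s"
    and Ks: "grid K \<le> 2 * s" "s \<le> 2 * grid K"
  proof (cases "s \<le> grid ?M")
    case True
    define K where "K = (LEAST k. 2 \<le> k \<and> s \<le> grid k)"
    have ex: "2 \<le> ?M \<and> s \<le> grid ?M" using True grid_max(1)[OF ss(1)] by simp
    have K: "2 \<le> K" "s \<le> grid K"
      using LeastI[of "\<lambda>k. 2 \<le> k \<and> s \<le> grid k", OF ex] by (auto simp: K_def)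
    have KM: "K \<le> ?M" unfolding K_def using ex by (rule Least_le)
    have K1: "grid (K - 1) \<le> s"
    proof (cases "K = 2")
      case True
      then show ?thesis using s by (simp add: grid_def)
    next
      case False
      then have "2 \<le> K - 1" "K - 1 < K" using K by auto
      with not_less_Least[of "K - 1" "\<lambda>k. 2 \<le> k \<and> s \<le> grid k"] show ?thesis
        unfolding K_def[symmetric] by simp
    qed
    have "pred_dist X (?g k) (?g (k - 1)) \<le> 2 * rate X \<sigma> C0 (grid k)"
      if "K \<le> k" "k \<le> ?M" for k
      using that K grid_mono[of K k] by (intro step) auto
    then have mK: "?m \<le> K" by (rule m_hat_le[OF K(1) KM])
    have "grid (?m - 1) \<le> grid (K - 1)" using mK by (intro grid_mono) simp
    moreover have "grid K = 2 * grid (K - 1)" using grid_Suc[of "K - 1"] K by simp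
    moreover have "grid K \<in> levels sstar s" using K KM by (auto simp: levels_def)
    ultimately show ?thesis using K K1 KM mK by (intro that[of K "grid K"]) linarith+
  next
    case False
    have "sstar < 2 * grid ?M" using less_grid_Suc_grid_max[OF ss(1)] grid_Suc[of ?M] grid_max(1)[OF ss(1)] by simp
    moreover have "grid (?m - 1) \<le> grid ?M" using m by (intro grid_mono) simp
    moreover have "s \<in> levels sstar s" by (simp add: levels_def)
    ultimately show ?thesis using False s m grid_max(1)[OF ss(1)] by (intro that[of ?M s]) auto
  qed
  show "s_hat X \<sigma> C0 sstar \<beta>h y \<le> s" unfolding s_hat_def by (rule K(4))
  have "2 * grid (?m - 1) = grid ?m" using grid_Suc[of "?m - 1"] m by simp
  then have bt: "beta_tilde X \<sigma> C0 sstar \<beta>h y = ?g ?m" by (simp add: beta_tilde_def s_hat_def)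
  have "s \<le> l" using levels_bounds[OF ss(1) s l(1)] by simp
  have k: "1 \<le> K" "1 \<le> ?m" "1 \<le> s" using K m s by auto
  have s_small: "real s \<le> real p / (2 * exp 1)" using s by (intro small) simp
  have "pred_dist X (?g ?m) \<beta> \<le> pred_dist X (?g ?m) (?g K) + pred_dist X (?g K) \<beta>"
    by (rule pred_dist_triangle[OF X gc[OF k(2) m(2)] gc[OF k(1) K(2)] \<beta>])
  also have "\<dots> \<le> 10 * ?w (grid K) + ?w l"
    using K l grid_ge_1 by (intro add_mono chain acc) auto
  also have "\<dots> \<le> 10 * (2 * ?w s) + 2 * ?w s"
    using Ks l \<open>s \<le> l\<close> k grid_ge_1 s_small
    by (intro add_mono mult_left_mono rate_comparable[OF X C0']) auto
  also have "\<dots> < 23 * ?w s" using rate_pos[OF X n C0 k(3) s_small] by simp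
  finally show "pred_dist X (beta_tilde X \<sigma> C0 sstar \<beta>h y) \<beta> < 23 * ?w s" unfolding bt .
qed

section \<open>Adaptation to the unknown sparsity\<close>

lemma column_norm_le:
  assumes X: "X \<in> carrier_mat n p" and "n \<ge> 1" "j < p" "emp_norm (X *\<^sub>v unit_vec p j) \<le> 1"
  shows "(\<Sum>i<n. (X $$ (i, j))\<^sup>2) \<le> real n"
proof -
  have "(emp_norm (X *\<^sub>v unit_vec p j))\<^sup>2 \<le> 1"
    using assms(4) emp_norm_nonneg by (simp add: power_le_one)
  moreover have "(\<Sum>i<n. ((X *\<^sub>v unit_vec p j) $ i)\<^sup>2) = (\<Sum>i<n. (X $$ (i, j))\<^sup>2)"
    using X assms(3) by (intro sum.cong) auto
  ultimately show ?thesis using X assms(2) by (simp add: emp_norm_sq)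
qed

lemma grid_max_le_two_log_sq:
  assumes "2 \<le> sstar" "real sstar \<le> real p / (2 * exp 1)"
  shows "real (grid_max sstar) \<le> 2 * (log 2 (real p))\<^sup>2"
proof -
  let ?M = "grid_max sstar"
  note M = grid_max(1)[OF assms(1)]
  have M1: "1 \<le> ?M" using M by simp
  have "2 * 1 \<le> 2 * exp (1::real)" using exp_ge_add_one_self[of "1::real"] by simp
  then have "real sstar * 2 \<le> real sstar * (2 * exp 1)" by (intro mult_left_mono) auto
  then have "real sstar * 2 \<le> real p" using assms(2) by (simp add: field_simps)
  then have sp: "2 * sstar \<le> p" by linarith
  have "2 ^ ?M = grid (Suc ?M)" by (simp add: grid_def)
  also have "\<dots> \<le> p" using grid_max(2)[OF assms(1) M1] grid_Suc[OF M1] sp by simp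
  finally have "2 ^ ?M \<le> real p" by (metis of_nat_le_iff of_nat_numeral of_nat_power)
  then have Mlog: "real ?M \<le> log 2 (real p)" using sp assms(1)
    by (subst le_log_iff) (auto simp: powr_realpow)
  then have l1: "1 \<le> log 2 (real p)" using M1 by linarith
  then have "log 2 (real p) \<le> (log 2 (real p))\<^sup>2" by (simp add: power2_eq_square)
  then show ?thesis using Mlog l1 by linarith
qed

text \<open>
  One exceptional event serves all targets in \<open>B0 p s\<close> at once, for the size of the error as well as for
  the selected sparsity.
\<close>

lemma adaptive_lasso_bad_event:
  assumes n: "n \<ge> 1" and \<sigma>: "\<sigma> > 0" and X: "X \<in> carrier_mat n p"
    and col: "\<forall>j<p. emp_norm (X *\<^sub>v unit_vec p j) \<le> 1"
    and las: "lasso_estimators X \<sigma> \<beta>h"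
    and ss: "2 \<le> sstar" "real sstar \<le> real p / (2 * exp 1)"
    and \<theta>: "theta X (2 * real sstar) 7 > 0"
    and C0: "C0 = 7 * (4 + sqrt 2) / (2 * theta X (2 * real sstar) 7)"
    and s: "s \<in> {1..sstar}"
  obtains Bad where "Bad \<in> sets (noise n \<sigma>)"
    and "measure (noise n \<sigma>) Bad \<le> 2 * (log 2 (real p))\<^sup>2 * (2 * real s / real p) ^ (2 * s)"
    and "\<And>\<xi> \<beta>. \<xi> \<in> space (noise n \<sigma>) - Bad \<Longrightarrow> \<beta> \<in> B0 p s \<Longrightarrow>
      s_hat X \<sigma> C0 sstar \<beta>h (X *\<^sub>v \<beta> + vec n \<xi>) \<le> s"
    and "\<And>\<xi> \<beta>. \<xi> \<in> space (noise n \<sigma>) - Bad \<Longrightarrow> \<beta> \<in> B0 p s \<Longrightarrow>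
      pred_dist X (beta_tilde X \<sigma> C0 sstar \<beta>h (X *\<^sub>v \<beta> + vec n \<xi>)) \<beta> < 23 * rate X \<sigma> C0 (real s)"
proof
  interpret P: prob_space "noise n \<sigma>" using \<sigma> by (rule prob_space_noise)
  let ?t = "\<lambda>m. 5 / 2 * sqrt (real m * ln (2 * exp 1 * real p / real m))"
  let ?E = "\<lambda>m. {\<xi> \<in> space (noise n \<sigma>). \<not> noise_controlled X m (?t m * \<sigma>) \<xi>}"
  let ?Bad = "\<Union>m\<in>levels sstar s. ?E m"
  let ?\<delta> = "(2 * real s / real p) ^ (2 * s)"
  have "sstar \<le> p" using ln_complexity_ge(2)[of sstar p] ss by simp
  then have p: "p \<ge> 1" using ss by simp
  have lev: "1 \<le> s" "s \<le> m" "m \<le> sstar" "real m \<le> real p / (2 * exp 1)" if "m \<in> levels sstar s" for m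
    using levels_bounds[OF ss(1) s that] s ss(2) by (auto intro: order_trans[of _ "real sstar"])
  have E: "?E m \<in> sets (noise n \<sigma>)" if "m \<in> levels sstar s" for m
  proof (rule noise_not_controlled_prob(1)[OF X \<sigma>])
    have "0 < ln (2::real)" by simp
    with ln_complexity_ge(1)[of m p] lev[OF that]
    have "0 \<le> ln (2 * exp 1 * real p / real m)" by linarith
    then show "?t m \<ge> 0" by simp
  qed
  show "?Bad \<in> sets (noise n \<sigma>)" using E by (intro sets.finite_UN finite_levels) auto
  have "measure (noise n \<sigma>) ?Bad \<le> (\<Sum>m\<in>levels sstar s. measure (noise n \<sigma>) (?E m))"
    using E by (intro P.finite_measure_subadditive_finite finite_levels) auto
  also have "\<dots> \<le> (\<Sum>m\<in>levels sstar s. ?\<delta>)"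
    using lev by (intro sum_mono noise_not_controlled_le[OF X \<sigma>]) auto
  also have "\<dots> = real (card (levels sstar s)) * ?\<delta>" by simp
  also have "\<dots> \<le> 2 * (log 2 (real p))\<^sup>2 * ?\<delta>"
    using card_levels_le[OF ss(1), of s] grid_max_le_two_log_sq[OF ss]
    by (intro mult_right_mono) auto
  finally show "measure (noise n \<sigma>) ?Bad \<le> 2 * (log 2 (real p))\<^sup>2 * ?\<delta>" .
  have "1 \<le> sqrt (2 * real sstar)" using ss(1) by (intro real_sqrt_ge_one) simp
  then have "1 * 1 \<le> (1 + 7) * sqrt (2 * real sstar)" by (intro mult_mono) simp_all
  then have "1 \<le> (1 + 7) * sqrt (2 * real sstar)" by (simp only: mult_1)
  then have \<theta>1: "theta X (2 * real sstar) 7 \<le> 1"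
    using col p by (intro theta_le_1[OF X p]) auto
  have "C0 > 0" unfolding C0 using \<theta> by (intro divide_pos_pos mult_pos_pos add_pos_nonneg) auto
  then have C0\<sigma>: "0 < C0 * \<sigma>" using \<sigma> by simp
  have good: "s_hat X \<sigma> C0 sstar \<beta>h (X *\<^sub>v \<beta> + vec n \<xi>) \<le> s \<and>
      pred_dist X (beta_tilde X \<sigma> C0 sstar \<beta>h (X *\<^sub>v \<beta> + vec n \<xi>)) \<beta> < 23 * rate X \<sigma> C0 (real s)"
    if \<xi>: "\<xi> \<in> space (noise n \<sigma>) - ?Bad" and \<beta>: "\<beta> \<in> B0 p s" for \<xi> \<beta>
  proof -
    let ?y = "X *\<^sub>v \<beta> + vec n \<xi>"
    have \<beta>': "\<beta> \<in> carrier_vec p" "l0 \<beta> \<le> s" using \<beta> by (auto simp: B0_def)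
    have y: "?y \<in> carrier_vec n" using X \<beta>' by simp
    have isl: "is_lasso X \<sigma> b ?y (\<beta>h b ?y)" if "1 \<le> b" "b \<le> p" for b
      using las y X that unfolding lasso_estimators_def by auto
    have c: "\<beta>h b ?y \<in> carrier_vec p" if "1 \<le> b" "b \<le> p" for b
      using isl[OF that] X unfolding is_lasso_def is_arg_min_def by auto
    have acc: "pred_dist X (\<beta>h b ?y) \<beta> \<le> rate X \<sigma> C0 (real m)"
      if m: "m \<in> levels sstar s" and b: "1 \<le> b" "b \<le> m" "m \<le> 2 * b" for m b
    proof -
      note lm = lev[OF m]
      have ctrl: "noise_controlled X m (?t m * \<sigma>) \<xi>" using \<xi> m by blast
      have cols: "\<And>j. j < p \<Longrightarrow> (\<Sum>i<n. (X $$ (i, j))\<^sup>2) \<le> real n"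
        using col by (intro column_norm_le[OF X n]) auto
      have l0m: "l0 \<beta> \<le> m" and bp: "b \<le> p" and k: "real m \<le> 2 * real sstar"
        using \<beta>' lm b \<open>sstar \<le> p\<close> by auto
      show ?thesis unfolding C0
        by (rule lasso_error_le_rate[OF X n \<sigma> cols \<beta>'(1) l0m b lm(4) k \<theta> \<theta>1 ctrl isl[OF b(1) bp]])
    qed
    show ?thesis
      using selection_of_accurate_fits[OF X n C0\<sigma> ss s \<beta>'(1), of \<beta>h ?y, OF c acc] by blast
  qed
  then show "\<And>\<xi> \<beta>. \<xi> \<in> space (noise n \<sigma>) - ?Bad \<Longrightarrow> \<beta> \<in> B0 p s \<Longrightarrow>
      s_hat X \<sigma> C0 sstar \<beta>h (X *\<^sub>v \<beta> + vec n \<xi>) \<le> s" by blast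
  show "\<And>\<xi> \<beta>. \<xi> \<in> space (noise n \<sigma>) - ?Bad \<Longrightarrow> \<beta> \<in> B0 p s \<Longrightarrow>
      pred_dist X (beta_tilde X \<sigma> C0 sstar \<beta>h (X *\<^sub>v \<beta> + vec n \<xi>)) \<beta> < 23 * rate X \<sigma> C0 (real s)"
    using good by blast
qed

theorem theorem5p1:
  shows "\<exists>C1 > (0::real).
    \<forall>(n::nat) (p::nat) (\<sigma>::real) (X::real mat) (\<beta>h::nat \<Rightarrow> real vec \<Rightarrow> real vec) (sstar::nat) (C0::real).
      n \<ge> 1 \<longrightarrow> p \<ge> 1 \<longrightarrow> \<sigma> > 0 \<longrightarrow>
      X \<in> carrier_mat n p \<longrightarrow> (\<forall>j<p. emp_norm (X *\<^sub>v unit_vec p j) \<le> 1) \<longrightarrow>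
      lasso_estimators X \<sigma> \<beta>h \<longrightarrow>
      sstar \<in> {2..p} \<longrightarrow> theta X (2 * real sstar) 7 > 0 \<longrightarrow> real sstar \<le> real p / (2 * exp 1) \<longrightarrow>
      C0 = 7 * (4 + sqrt 2) / (2 * theta X (2 * real sstar) 7) \<longrightarrow>
      (\<forall>s\<in>{1..sstar}.
        (SUP \<beta>\<in>B0 p s. model_prob X \<sigma> \<beta> (\<lambda>y.
            emp_norm (X *\<^sub>v (beta_tilde X \<sigma> C0 sstar \<beta>h y - \<beta>))
              \<ge> C1 * C0 * \<sigma> * sqrt (real s * ln (2 * exp 1 * real p / real s) / real n)))
          \<le> (2 * (log 2 (real p))\<^sup>2 + 1) * (2 * real s / real p) ^ (2 * s) \<and>
        (INF \<beta>\<in>B0 p s. model_prob X \<sigma> \<beta> (\<lambda>y. s_hat X \<sigma> C0 sstar \<beta>h y \<le> s))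
          \<ge> 1 - 2 * (log 2 (real p))\<^sup>2 * (2 * real s / real p) ^ (2 * s))"
proof (intro exI[of _ "23::real"] conjI allI impI ballI)
  fix n p :: nat and \<sigma> :: real and X :: "real mat" and \<beta>h :: "nat \<Rightarrow> real vec \<Rightarrow> real vec"
    and sstar s :: nat and C0 :: real
  assume n: "n \<ge> 1" and "p \<ge> 1" and \<sigma>: "\<sigma> > 0" and X: "X \<in> carrier_mat n p"
    and col: "\<forall>j<p. emp_norm (X *\<^sub>v unit_vec p j) \<le> 1" and las: "lasso_estimators X \<sigma> \<beta>h"
    and sstar: "sstar \<in> {2..p}" and \<theta>: "theta X (2 * real sstar) 7 > 0"
    and small: "real sstar \<le> real p / (2 * exp 1)"
    and C0: "C0 = 7 * (4 + sqrt 2) / (2 * theta X (2 * real sstar) 7)"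
    and s: "s \<in> {1..sstar}"
  interpret P: prob_space "noise n \<sigma>" using \<sigma> by (rule prob_space_noise)
  let ?\<delta> = "(2 * real s / real p) ^ (2 * s)"
  have ss: "2 \<le> sstar" "sstar \<le> p" using sstar by auto
  have dims: "dim_row X = n" "dim_col X = p" using X by auto
  obtain Bad where Bad: "Bad \<in> sets (noise n \<sigma>)"
      "measure (noise n \<sigma>) Bad \<le> 2 * (log 2 (real p))\<^sup>2 * ?\<delta>"
    and sel: "\<And>\<xi> \<beta>. \<xi> \<in> space (noise n \<sigma>) - Bad \<Longrightarrow> \<beta> \<in> B0 p s \<Longrightarrow>
      s_hat X \<sigma> C0 sstar \<beta>h (X *\<^sub>v \<beta> + vec n \<xi>) \<le> s"
    and err: "\<And>\<xi> \<beta>. \<xi> \<in> space (noise n \<sigma>) - Bad \<Longrightarrow> \<beta> \<in> B0 p s \<Longrightarrow>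
      pred_dist X (beta_tilde X \<sigma> C0 sstar \<beta>h (X *\<^sub>v \<beta> + vec n \<xi>)) \<beta> < 23 * rate X \<sigma> C0 (real s)"
    using adaptive_lasso_bad_event[OF n \<sigma> X col las ss(1) small \<theta> C0 s] by blast
  have ne: "B0 p s \<noteq> {}"
  proof -
    have "0\<^sub>v p \<in> B0 p s" by (simp add: B0_def l0_def cong: conj_cong)
    then show ?thesis by blast
  qed
  show "(SUP \<beta>\<in>B0 p s. model_prob X \<sigma> \<beta> (\<lambda>y.
            emp_norm (X *\<^sub>v (beta_tilde X \<sigma> C0 sstar \<beta>h y - \<beta>))
              \<ge> 23 * C0 * \<sigma> * sqrt (real s * ln (2 * exp 1 * real p / real s) / real n)))
          \<le> (2 * (log 2 (real p))\<^sup>2 + 1) * ?\<delta>"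
  proof (rule cSUP_least[OF ne])
    fix \<beta> assume \<beta>: "\<beta> \<in> B0 p s"
    have "model_prob X \<sigma> \<beta> (\<lambda>y. emp_norm (X *\<^sub>v (beta_tilde X \<sigma> C0 sstar \<beta>h y - \<beta>))
              \<ge> 23 * C0 * \<sigma> * sqrt (real s * ln (2 * exp 1 * real p / real s) / real n))
        \<le> measure (noise n \<sigma>) Bad"
      unfolding model_prob_def dims
    proof (rule P.finite_measure_mono[OF _ Bad(1)], rule subsetI, rule ccontr)
      fix \<xi> assume "\<xi> \<in> {\<xi> \<in> space (noise n \<sigma>).
          emp_norm (X *\<^sub>v (beta_tilde X \<sigma> C0 sstar \<beta>h (X *\<^sub>v \<beta> + vec n \<xi>) - \<beta>))
            \<ge> 23 * C0 * \<sigma> * sqrt (real s * ln (2 * exp 1 * real p / real s) / real n)}"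
        and "\<xi> \<notin> Bad"
      with err[of \<xi> \<beta>] \<beta> show False by (simp add: pred_dist_def rate_def dims mult.assoc)
    qed
    also have "\<dots> \<le> (2 * (log 2 (real p))\<^sup>2 + 1) * ?\<delta>" 
    proof -
      have "0 \<le> ?\<delta>" by simp
      with Bad(2) show ?thesis by (simp only: distrib_right mult_1)
    qed
    finally show "model_prob X \<sigma> \<beta> (\<lambda>y. emp_norm (X *\<^sub>v (beta_tilde X \<sigma> C0 sstar \<beta>h y - \<beta>))
              \<ge> 23 * C0 * \<sigma> * sqrt (real s * ln (2 * exp 1 * real p / real s) / real n))
        \<le> (2 * (log 2 (real p))\<^sup>2 + 1) * ?\<delta>" .
  qed
  show "1 - 2 * (log 2 (real p))\<^sup>2 * ?\<delta>
      \<le> (INF \<beta>\<in>B0 p s. model_prob X \<sigma> \<beta> (\<lambda>y. s_hat X \<sigma> C0 sstar \<beta>h y \<le> s))"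
  proof (rule cINF_greatest[OF ne])
    fix \<beta> assume \<beta>: "\<beta> \<in> B0 p s"
    then have \<beta>': "\<beta> \<in> carrier_vec p" by (simp add: B0_def)
    let ?S = "{\<xi> \<in> space (noise n \<sigma>). s_hat X \<sigma> C0 sstar \<beta>h (X *\<^sub>v \<beta> + vec n \<xi>) \<le> s}"
    have "?S \<in> sets (noise n \<sigma>)"
      using events_measurable(2)[OF X n _ las ss \<beta>', of C0 s] \<sigma> by (simp add: pred_def)
    moreover have "space (noise n \<sigma>) - Bad \<subseteq> ?S" using sel \<beta> by blast
    ultimately have "measure (noise n \<sigma>) (space (noise n \<sigma>) - Bad) \<le> measure (noise n \<sigma>) ?S"
      by (intro P.finite_measure_mono)
    then show "1 - 2 * (log 2 (real p))\<^sup>2 * ?\<delta> \<le> model_prob X \<sigma> \<beta> (\<lambda>y. s_hat X \<sigma> C0 sstar \<beta>h y \<le> s)"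
      unfolding model_prob_def dims using P.prob_compl[OF Bad(1)] Bad(2) by linarith
  qed
qed simp

end
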